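(* Assume that $2^\omega$ is not the union of fewer than $2^{\aleph_0}$ meager sets. Then there exist sets of reals $X_1, X_2$, each satisfying $\mathsf{S}_1(\mathcal{B}_\Omega,\mathcal{B}_\Omega)$, such that $X_1\cup X_2$ does not satisfy $\mathsf{U}_{fin}(\Gamma,\Omega)$.
   Context: A set of reals is a subset of $\mathbb{R}\setminus\mathbb{Q}$ (equivalently, up to homeomorphism, a separable zero-dimensional metric space). For a set of reals $X$, a countable cover $\mathcal{U}$ of $X$ (by open, resp. Borel, sets) is an $\omega$-cover if $X\notin\mathcal{U}$ and every finite $F\subseteq X$ is contained in some $U\in\mathcal{U}$; a countable open cover is a $\gamma$-cover if it is infinite and each $x\in X$ lies outside only finitely many of its members. $\mathcal{B}_\Omega$ denotes the collection of countable Borel $\omega$-covers of $X$, $\Omega$ the collection of countable open $\omega$-covers, and $\Gamma$ the collection of countable open $\gamma$-covers. $X$ satisfies $\mathsf{S}_1(\mathcal{B}_\Omega,\mathcal{B}_\Omega)$ if for every sequence $\langle \mathcal{U}_n:n\in\omega\rangle$ of countable Borel $\omega$-covers of $X$ there are $U_n\in\mathcal{U}_n$ such that $\{U_n:n\in\omega\}$ is a countable Borel $\omega$-cover of $X$. $X$ satisfies $\mathsf{U}_{fin}(\Gamma,\Omega)$ if for every sequence $\langle \mathcal{U}_n:n\in\omega\rangle$ of open $\gamma$-covers of $X$, none of which contains a finite subcover, there are finite $\mathcal{V}_n\subseteq\mathcal{U}_n$ such that $\{\bigcup\mathcal{V}_n:n\in\omega\}$ is an open $\omega$-cover of $X$.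 *)

theory Defs
  imports "HOL-Analysis.Analysis" "HOL-Library.Equipollence"
begin

definition nowhere_dense :: "'a::topological_space set \<Rightarrow> bool" where
  "nowhere_dense A \<longleftrightarrow> interior (closure A) = {}"

definition meager :: "'a::topological_space set \<Rightarrow> bool" where
  "meager A \<longleftrightarrow> (\<exists>N :: nat \<Rightarrow> 'a set. (\<forall>n. nowhere_dense (N n)) \<and> A = (\<Union>n. N n))"

text \<open>A cover of \<open>X\<close> consists of subsets of the space \<open>X\<close> that are open
  (resp. Borel) in its subspace topology, so that \<open>X \<notin> \<U>\<close> says that no
  member of \<open>\<U>\<close> contains all of \<open>X\<close>.\<close>

definition countable_open_cover :: "'a::topological_space set \<Rightarrow> 'a set set \<Rightarrow> bool" where
  "countable_open_cover X \<U> \<longleftrightarrow>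
     countable \<U> \<and> (\<forall>U\<in>\<U>. openin (top_of_set X) U) \<and> \<Union>\<U> = X"

definition countable_borel_cover :: "'a::topological_space set \<Rightarrow> 'a set set \<Rightarrow> bool" where
  "countable_borel_cover X \<U> \<longleftrightarrow>
     countable \<U> \<and> (\<forall>U\<in>\<U>. U \<in> sets (restrict_space borel X)) \<and> \<Union>\<U> = X"

definition omega_covering :: "'a set \<Rightarrow> 'a set set \<Rightarrow> bool" where
  "omega_covering X \<U> \<longleftrightarrow>
     X \<notin> \<U> \<and> (\<forall>F. finite F \<and> F \<subseteq> X \<longrightarrow> (\<exists>U\<in>\<U>. F \<subseteq> U))"

definition gamma_covering :: "'a set \<Rightarrow> 'a set set \<Rightarrow> bool" where
  "gamma_covering X \<U> \<longleftrightarrow> infinite \<U> \<and> (\<forall>x\<in>X. finite {U\<in>\<U>. x \<notin> U})"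

definition B_Omega :: "'a::topological_space set \<Rightarrow> 'a set set set" where
  "B_Omega X = {\<U>. countable_borel_cover X \<U> \<and> omega_covering X \<U>}"

definition Omega :: "'a::topological_space set \<Rightarrow> 'a set set set" where
  "Omega X = {\<U>. countable_open_cover X \<U> \<and> omega_covering X \<U>}"

definition Gamma_covers :: "'a::topological_space set \<Rightarrow> 'a set set set" where
  "Gamma_covers X = {\<U>. countable_open_cover X \<U> \<and> gamma_covering X \<U>}"

definition S1 :: "'a set set set \<Rightarrow> 'a set set set \<Rightarrow> bool" where
  "S1 \<A> \<B> \<longleftrightarrow>
     (\<forall>\<U> :: nat \<Rightarrow> 'a set set. (\<forall>n. \<U> n \<in> \<A>) \<longrightarrow>
        (\<exists>U :: nat \<Rightarrow> 'a set. (\<forall>n. U n \<in> \<U> n) \<and> range U \<in> \<B>))"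

definition Ufin :: "'a set \<Rightarrow> 'a set set set \<Rightarrow> 'a set set set \<Rightarrow> bool" where
  "Ufin X \<A> \<B> \<longleftrightarrow>
     (\<forall>\<U> :: nat \<Rightarrow> 'a set set.
        (\<forall>n. \<U> n \<in> \<A> \<and> \<not> (\<exists>\<F>. finite \<F> \<and> \<F> \<subseteq> \<U> n \<and> \<Union>\<F> = X)) \<longrightarrow>
        (\<exists>\<V> :: nat \<Rightarrow> 'a set set.
           (\<forall>n. finite (\<V> n) \<and> \<V> n \<subseteq> \<U> n) \<and> range (\<lambda>n. \<Union>(\<V> n)) \<in> \<B>))"

end

theory Submission
  imports Defs "HOL-Algebra.Free_Abelian_Groups"
begin

text \<open>
  Everything takes place in \<open>2\<^sup>\<omega>\<close>, which is embedded into the reals at the end; generic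
  points avoid the countably many preimages of rationals. The sequences of countable families
  of Borel sets and the functions \<open>g \<in> \<omega>\<^sup>\<omega>\<close> are enumerated in order type continuum. At
  stage \<open>\<alpha>\<close> one selects a member from each of the families of the \<open>\<alpha>\<close>-th sequence by a
  generic choice and then adds a pair of generic points \<open>x, y\<close>, one to each set, of which for
  every \<open>n\<close> one has no nonzero entry among the first \<open>g n + 1\<close> entries of its \<open>n\<close>-th column.
  Each step has to avoid fewer than continuum many meager sets.

  If the families turn out to be \<open>\<omega>\<close>-covers of the final set, they are
  \<open>\<omega>\<close>-covers modulo the meager ideal, since points added after stage \<open>\<alpha>\<close> in finitely many
  given open sets avoid all members that are meager there. Then the generic selection is such
  an \<open>\<omega>\<close>-cover too, and adding generic points preserves this. On the other hand, the pairs
  \<open>x, y\<close> show that the functions sending \<open>n\<close> to the position of the first one in column \<open>n\<close>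
  form a finitely dominating family, so the union of the two sets fails the covering property.
\<close>

section \<open>The meager ideal and the Baire property\<close>

lemma nowhere_dense_subset: "nowhere_dense A \<Longrightarrow> B \<subseteq> A \<Longrightarrow> nowhere_dense B"
  unfolding nowhere_dense_def by (metis closure_mono interior_mono subset_empty)

lemma meagerI: "(\<And>n::nat. nowhere_dense (N n)) \<Longrightarrow> A = (\<Union>n. N n) \<Longrightarrow> meager A"
  unfolding meager_def by blast

lemma meager_subset:
  assumes "meager A" "B \<subseteq> A"
  shows "meager B"
proof -
  obtain N where N: "\<forall>n::nat. nowhere_dense (N n)" "A = (\<Union>n. N n)"
    using assms by (auto simp: meager_def)
  have "\<forall>n. nowhere_dense (N n \<inter> B)" "B = (\<Union>n. N n \<inter> B)"
    using N assms(2) nowhere_dense_subset[OF _ Int_lower1] by auto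
  then show ?thesis
    using meagerI by metis
qed

lemma nowhere_dense_imp_meager: "nowhere_dense A \<Longrightarrow> meager A"
  by (rule meagerI[of "\<lambda>_. A"]) auto

lemma meager_empty [simp]: "meager {}"
  by (rule nowhere_dense_imp_meager) (simp add: nowhere_dense_def)

lemma meager_UN_nat:
  assumes "\<And>n::nat. meager (A n)"
  shows "meager (\<Union>n. A n)"
proof -
  have "\<forall>n. \<exists>N. (\<forall>k::nat. nowhere_dense (N k)) \<and> A n = (\<Union>k. N k)"
    using assms by (simp add: meager_def)
  then obtain N where N: "\<And>n k::nat. nowhere_dense (N n k)" "\<And>n. A n = (\<Union>k. N n k)"
    by metis
  have "(\<Union>n. A n) = (\<Union>j. N (fst (prod_decode j)) (snd (prod_decode j)))" (is "_ = ?R")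
  proof
    show "(\<Union>n. A n) \<subseteq> ?R"
    proof
      fix x assume "x \<in> (\<Union>n. A n)"
      then obtain n k where "x \<in> N n k" by (auto simp: N)
      then show "x \<in> ?R" by (intro UN_I[of "prod_encode (n, k)"]) auto
    qed
  qed (auto simp: N)
  then show ?thesis
    by (rule meagerI[rotated]) (rule N(1))
qed

lemma meager_UN:
  assumes "countable I" "\<And>i. i \<in> I \<Longrightarrow> meager (A i)"
  shows "meager (\<Union>i\<in>I. A i)"
proof (cases "I = {}")
  case False
  have "(\<Union>i\<in>I. A i) = (\<Union>n. A (from_nat_into I n))"
    using range_from_nat_into[OF False assms(1)] by (metis image_image)
  then show ?thesis
    using meager_UN_nat[of "\<lambda>n. A (from_nat_into I n)"] assms(2) from_nat_into[OF False] by simp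
qed simp

lemma meager_Un: "meager A \<Longrightarrow> meager B \<Longrightarrow> meager (A \<union> B)"
  using meager_UN[of "{A, B}" "\<lambda>S. S"] by auto

text \<open>The sets that agree with an open set up to a meager set include the open sets and are
  closed under complements and countable unions; the induction along \<open>sigma_sets\<close> uses
  exactly these facts.\<close>

lemma borel_has_baire_property:
  fixes A :: "'a::topological_space set"
  assumes "A \<in> sets borel"
  shows "\<exists>G. open G \<and> meager ((A - G) \<union> (G - A))"
proof -
  have "A \<in> sigma_sets UNIV {S. open S}"
    using assms by (simp add: borel_def)
  then show ?thesis
  proof induction
    case (Basic a)
    then show ?case by (intro exI[of _ a]) simp
  next
    case Empty
    show ?case by (intro exI[of _ "{}"]) simp
  next
    case (Compl a)
    then obtain G where G: "open G" "meager ((a - G) \<union> (G - a))" by blast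
    \<comment> \<open>The complement of \<open>G\<close> is only closed. Its interior is the open
      approximation, and what is lost is a closed set with empty interior.\<close>
    let ?H = "interior (- G)"
    have nd: "nowhere_dense (- G - ?H)"
    proof -
      have "closed (- G - ?H)"
        using G(1) by (simp add: closed_Diff closed_Compl)
      moreover have "interior (- G - ?H) = {}"
      proof -
        have "interior (- G - ?H) \<subseteq> ?H" by (intro interior_mono) auto
        then show ?thesis using interior_subset[of "- G - ?H"] by blast
      qed
      ultimately show ?thesis by (simp add: nowhere_dense_def closure_closed)
    qed
    have "(UNIV - a - ?H) \<union> (?H - (UNIV - a)) \<subseteq> ((a - G) \<union> (G - a)) \<union> (- G - ?H)"
      using interior_subset[of "- G"] by blast
    then have "meager ((UNIV - a - ?H) \<union> (?H - (UNIV - a)))"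
      using meager_subset meager_Un[OF G(2) nowhere_dense_imp_meager[OF nd]] by blast
    then show ?case by (intro exI[of _ ?H]) simp
  next
    case (Union a)
    then obtain G where G: "\<And>i::nat. open (G i)" "\<And>i. meager ((a i - G i) \<union> (G i - a i))"
      by metis
    have "((\<Union>i. a i) - (\<Union>i. G i)) \<union> ((\<Union>i. G i) - (\<Union>i. a i)) \<subseteq> (\<Union>i. (a i - G i) \<union> (G i - a i))"
      by blast
    then have "meager (((\<Union>i. a i) - (\<Union>i. G i)) \<union> ((\<Union>i. G i) - (\<Union>i. a i)))"
      by (rule meager_subset[OF meager_UN_nat[OF G(2)]])
    then show ?case using G(1) by (intro exI[of _ "\<Union>i. G i"] conjI open_UN) auto
  qed
qed

section \<open>Category in the Cantor space\<close>

text \<open>A finite binary string is represented by a total sequence cut off at length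
  \<open>K\<close>, which makes \<open>u\<close> itself a ready witness of nonemptiness.\<close>

definition cyl :: "(nat \<Rightarrow> bool) \<Rightarrow> nat \<Rightarrow> (nat \<Rightarrow> bool) set" where
  "cyl u K = {x. \<forall>k<K. x k = u k}"

lemma cyl_self [simp]: "u \<in> cyl u K"
  by (simp add: cyl_def)

lemma open_cyl: "open (cyl u K)"
proof -
  have "cyl u K = {f. \<forall>i\<in>{..<K}. f (id i) \<in> {u i}}"
    by (auto simp: cyl_def)
  then show ?thesis
    using product_topology_basis'[of "{..<K}" "\<lambda>i. {u i}" id] by (simp add: open_discrete)
qed

lemma open_contains_cyl:
  assumes "open G" "u \<in> G"
  obtains K where "cyl u K \<subseteq> G"
proof -
  obtain X where X: "u \<in> (\<Pi>\<^sub>E i\<in>UNIV. X i)" "finite {i. X i \<noteq> UNIV}" "(\<Pi>\<^sub>E i\<in>UNIV. X i) \<subseteq> G"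
    using product_topology_open_contains_basis[of "\<lambda>_. euclidean" UNIV G u] assms
    by (auto simp: open_fun_def)
  obtain K where K: "\<forall>i\<in>{i. X i \<noteq> UNIV}. i < K"
    using X(2) finite_nat_set_iff_bounded by blast
  have "x \<in> (\<Pi>\<^sub>E i\<in>UNIV. X i)" if "x \<in> cyl u K" for x
  proof -
    have "x i \<in> X i" for i
    proof (cases "i < K")
      case True
      then show ?thesis using that X(1) by (auto simp: cyl_def PiE_iff)
    next
      case False
      then show ?thesis using K by auto
    qed
    then show ?thesis by auto
  qed
  then show ?thesis using that X(3) by blast
qed

lemma nowhere_denseI_cyl:
  assumes "\<And>u K. \<exists>v L. cyl v L \<subseteq> cyl u K \<and> cyl v L \<inter> A = {}"
  shows "nowhere_dense A"
proof (rule ccontr)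
  assume "\<not> nowhere_dense A"
  then obtain u where u: "u \<in> interior (closure A)"
    by (auto simp: nowhere_dense_def)
  obtain K where K: "cyl u K \<subseteq> interior (closure A)"
    using open_contains_cyl[OF open_interior u] by blast
  obtain v L where v: "cyl v L \<subseteq> cyl u K" "cyl v L \<inter> A = {}"
    using assms by blast
  have "cyl v L \<inter> closure A = {}"
    using v(2) open_Int_closure_eq_empty[OF open_cyl] by blast
  moreover have "v \<in> closure A"
    using v(1) K interior_subset cyl_self by blast
  ultimately show False using cyl_self by blast
qed

lemma nowhere_dense_cylE:
  assumes "nowhere_dense A"
  obtains v L where "cyl v L \<subseteq> cyl u K" "cyl v L \<inter> A = {}"
proof -
  have "\<not> cyl u K \<subseteq> closure A"
    using assms interior_maximal[OF _ open_cyl] cyl_self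
    unfolding nowhere_dense_def by blast
  then obtain v where v: "v \<in> cyl u K" "v \<notin> closure A" by blast
  have "open (cyl u K - closure A)" by (simp add: open_cyl open_Diff)
  then obtain L where "cyl v L \<subseteq> cyl u K - closure A"
    using open_contains_cyl v by blast
  then show ?thesis using that closure_subset by blast
qed

text \<open>Numbering the cylinders through the countable type \<open>bool list\<close> leaves only
  countably many finite sets of them to consider.\<close>

definition basic :: "nat \<Rightarrow> (nat \<Rightarrow> bool) set" where
  "basic m = (let s = from_nat m :: bool list in cyl (\<lambda>k. s ! k) (length s))"

lemma basic_eq_cyl: "\<exists>u K. basic m = cyl u K"
  by (auto simp: basic_def Let_def)

lemma open_basic: "open (basic m)"
  using basic_eq_cyl[of m] open_cyl by auto

lemma cyl_eq_basic: "\<exists>m. cyl u K = basic m"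
proof -
  let ?s = "map u [0..<K]"
  have "basic (to_nat ?s) = cyl u K"
    by (auto simp: basic_def cyl_def)
  then show ?thesis by metis
qed

lemma open_contains_basic:
  assumes "open G" "u \<in> G"
  obtains m where "basic m \<subseteq> G"
  using open_contains_cyl[OF assms] cyl_eq_basic by metis

text \<open>Let the open set \<open>G\<close> equal \<open>A\<close> modulo a meager set. If
  \<open>- G\<close> had interior points, \<open>A\<close> would be meager in some basic set; hence
  \<open>- G\<close> is nowhere dense.\<close>

lemma meager_Compl_if_borel_nonmeager_in_basic:
  assumes "A \<in> sets borel" "\<And>m. \<not> meager (A \<inter> basic m)"
  shows "meager (- A)"
proof -
  obtain G where G: "open G" "meager ((A - G) \<union> (G - A))"
    using borel_has_baire_property[OF assms(1)] by blast
  have "interior (- G) = {}"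
  proof (rule ccontr)
    assume "interior (- G) \<noteq> {}"
    then obtain m where "basic m \<subseteq> interior (- G)"
      using open_contains_basic[OF open_interior] by blast
    then have "A \<inter> basic m \<subseteq> (A - G) \<union> (G - A)"
      using interior_subset by blast
    then show False using assms(2) meager_subset[OF G(2)] by blast
  qed
  then have "nowhere_dense (- G)"
    using G(1) by (simp add: nowhere_dense_def closure_closed closed_Compl)
  moreover have "- A \<subseteq> ((A - G) \<union> (G - A)) \<union> - G" by blast
  ultimately show ?thesis
    using meager_subset meager_Un[OF G(2) nowhere_dense_imp_meager] by blast
qed

text \<open>A weak form of openness: images of cylinders have nonempty interior. Together with
  continuity this suffices to pull meager sets back to meager sets.\<close>

definition nondegenerate :: "((nat \<Rightarrow> bool) \<Rightarrow> (nat \<Rightarrow> bool)) \<Rightarrow> bool" where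
  "nondegenerate \<phi> \<longleftrightarrow> continuous_on UNIV \<phi> \<and> (\<forall>u K. \<exists>v L. cyl v L \<subseteq> \<phi> ` cyl u K)"

text \<open>A cylinder inside the image of a given one can be shrunk to miss a nowhere dense set; by
  continuity, some cylinder around a preimage of its center is mapped into it.\<close>

lemma meager_vimage:
  assumes "nondegenerate \<phi>" "meager A"
  shows "meager (\<phi> -` A)"
proof -
  have *: "nowhere_dense (\<phi> -` N)" if N: "nowhere_dense N" for N
  proof (rule nowhere_denseI_cyl)
    fix u K
    obtain v L where v: "cyl v L \<subseteq> \<phi> ` cyl u K"
      using assms(1) unfolding nondegenerate_def by blast
    obtain v' L' where v': "cyl v' L' \<subseteq> cyl v L" "cyl v' L' \<inter> N = {}"
      using nowhere_dense_cylE[OF N] by blast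
    obtain w where w: "w \<in> cyl u K" "\<phi> w = v'"
      using v v'(1) cyl_self[of v' L'] by blast
    have "open (\<phi> -` cyl v' L' \<inter> cyl u K)"
      using assms(1) by (intro open_Int open_cyl open_vimage) (auto simp: nondegenerate_def)
    then obtain M where "cyl w M \<subseteq> \<phi> -` cyl v' L' \<inter> cyl u K"
      using open_contains_cyl[of "\<phi> -` cyl v' L' \<inter> cyl u K" w] w cyl_self by blast
    then show "\<exists>v L. cyl v L \<subseteq> cyl u K \<and> cyl v L \<inter> \<phi> -` N = {}"
      using v'(2) by (intro exI[of _ w] exI[of _ M]) auto
  qed
  obtain N where N: "\<And>n::nat. nowhere_dense (N n)" "A = (\<Union>n. N n)"
    using assms(2) by (auto simp: meager_def)
  have "\<phi> -` A = (\<Union>n. \<phi> -` N n)" using N by auto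
  then show ?thesis by (rule meagerI[rotated]) (rule *[OF N(1)])
qed

text \<open>\<open>good F V\<close> says that \<open>V\<close> is an \<open>\<omega>\<close>-cover modulo the meager ideal, relative to
  \<open>F\<close>: some member of \<open>V\<close> contains \<open>F\<close> and is nonmeager in each of finitely many
  prescribed open sets. Generic points preserve this, which keeps an \<open>\<omega>\<close>-cover selected at
  an early stage an \<open>\<omega>\<close>-cover when points are added later.\<close>

definition good :: "(nat \<Rightarrow> bool) set \<Rightarrow> (nat \<Rightarrow> (nat \<Rightarrow> bool) set) \<Rightarrow> bool" where
  "good F V \<longleftrightarrow> (\<forall>T. finite T \<longrightarrow> (\<exists>k. F \<subseteq> V k \<and> (\<forall>m\<in>T. \<not> meager (V k \<inter> basic m))))"

text \<open>For each finite \<open>T\<close> the union \<open>A T\<close> of the members that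
  witness goodness for \<open>T\<close> is comeager, and any point in all of these unions keeps
  goodness. There are only countably many \<open>T\<close>.\<close>

lemma meager_not_good_insert:
  assumes "good F V" "\<And>k. V k \<in> sets borel"
  shows "meager {x. \<not> good (insert x F) V}"
proof -
  define A where "A T = (\<Union>k\<in>{k. F \<subseteq> V k \<and> (\<forall>m\<in>T. \<not> meager (V k \<inter> basic m))}. V k)" for T
  have "meager (- A T)" if "finite T" for T
  proof (rule meager_Compl_if_borel_nonmeager_in_basic)
    show "A T \<in> sets borel"
      unfolding A_def using assms(2) by (intro sets.countable_UN') auto
    fix m
    \<comment> \<open>Goodness is applied to \<open>insert m T\<close>, so that the witness for
      \<open>T\<close> is nonmeager in the arbitrary \<open>basic m\<close> as well.\<close>
    obtain k where k: "F \<subseteq> V k" "\<forall>j\<in>insert m T. \<not> meager (V k \<inter> basic j)"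
      using assms(1) \<open>finite T\<close> unfolding good_def by (meson finite_insert)
    then have "V k \<inter> basic m \<subseteq> A T \<inter> basic m"
      unfolding A_def by auto
    then show "\<not> meager (A T \<inter> basic m)"
      using k(2) meager_subset by blast
  qed
  then have "meager (\<Union>T\<in>Collect finite. - A T)"
    by (intro meager_UN countable_Collect_finite) auto
  moreover have "{x. \<not> good (insert x F) V} \<subseteq> (\<Union>T\<in>Collect finite. - A T)"
  proof
    fix x assume "x \<in> {x. \<not> good (insert x F) V}"
    then obtain T where "finite T" "\<forall>k. insert x F \<subseteq> V k \<longrightarrow> (\<exists>m\<in>T. meager (V k \<inter> basic m))"
      by (auto simp: good_def)
    then have "x \<notin> A T" by (auto simp: A_def)
    then show "x \<in> (\<Union>T\<in>Collect finite. - A T)" using \<open>finite T\<close> by blast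
  qed
  ultimately show ?thesis by (rule meager_subset)
qed

text \<open>Reads an element of the Baire space off \<open>b\<close>. The value is unspecified on a column
  without ones; no property of it is needed there.\<close>

definition select :: "(nat \<Rightarrow> bool) \<Rightarrow> nat \<Rightarrow> nat" where
  "select b n = (LEAST m. b (prod_encode (n, m)))"

text \<open>For a fixed finite \<open>T\<close> a suitable member from a single family is enough,
  and a finite initial part of \<open>b\<close> always leaves the choice from some family open.
  Failure for \<open>T\<close> is therefore nowhere dense.\<close>

lemma meager_not_good_select:
  assumes "\<And>n. good F (E n)"
  shows "meager {b. \<not> good F (\<lambda>n. E n (select b n))}"
proof -
  define Q where "Q T n k \<longleftrightarrow> F \<subseteq> E n k \<and> (\<forall>m\<in>T. \<not> meager (E n k \<inter> basic m))" for T n k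
  have "nowhere_dense {b. \<not> (\<exists>n. Q T n (select b n))}" if "finite T" for T
  proof (rule nowhere_denseI_cyl)
    fix u K
    obtain k where k: "Q T K k"
      using assms \<open>finite T\<close> unfolding good_def Q_def by blast
    \<comment> \<open>Column \<open>K\<close> lies entirely at positions \<ge> \<open>K\<close>,
      beyond the prescribed entries. As its only one is entry \<open>k\<close>,
      \<open>select\<close> picks member \<open>k\<close> of family \<open>K\<close>.\<close>
    define v where "v i = (if i < K then u i else i = prod_encode (K, k))" for i
    obtain L where L: "\<forall>i \<in> insert K ((\<lambda>j. prod_encode (K, j)) ` {..k}). i < L"
      using finite_nat_set_iff_bounded by (metis finite_atMost finite_imageI finite_insert)
    have "select b K = k" if "b \<in> cyl v L" for b
      unfolding select_def
    proof (rule Least_equality)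
      have b: "b (prod_encode (K, j)) \<longleftrightarrow> j = k" if "j \<le> k" for j
      proof -
        have "b (prod_encode (K, j)) = v (prod_encode (K, j))"
          using \<open>b \<in> cyl v L\<close> L that by (auto simp: cyl_def)
        moreover have "K \<le> prod_encode (K, j)" by (rule le_prod_encode_1)
        ultimately show ?thesis by (simp add: v_def)
      qed
      then show "b (prod_encode (K, k))" by simp
      show "k \<le> j" if "b (prod_encode (K, j))" for j
        using b[of j] that by (cases "j \<le> k") auto
    qed
    then have "cyl v L \<inter> {b. \<not> (\<exists>n. Q T n (select b n))} = {}"
      using k by blast
    moreover have "cyl v L \<subseteq> cyl u K"
      using L by (auto simp: cyl_def v_def)
    ultimately show "\<exists>v L. cyl v L \<subseteq> cyl u K \<and> cyl v L \<inter> {b. \<not> (\<exists>n. Q T n (select b n))} = {}"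
      by blast
  qed
  then have "meager (\<Union>T\<in>Collect finite. {b. \<not> (\<exists>n. Q T n (select b n))})"
    by (intro meager_UN countable_Collect_finite) (auto intro: nowhere_dense_imp_meager)
  moreover have "{b. \<not> good F (\<lambda>n. E n (select b n))} \<subseteq> \<dots>"
    unfolding good_def Q_def by blast
  ultimately show ?thesis by (rule meager_subset)
qed

section \<open>Coding a pair of points by a single one\<close>

lemma continuous_on_cylI:
  fixes \<phi> :: "(nat \<Rightarrow> bool) \<Rightarrow> (nat \<Rightarrow> bool)"
  assumes "\<And>z i. \<exists>K. \<forall>z'\<in>cyl z K. \<phi> z' i = \<phi> z i"
  shows "continuous_on UNIV \<phi>"
proof (rule continuous_on_coordinatewise_then_product)
  fix i
  have "open ((\<lambda>z. \<phi> z i) -` B)" for B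
  proof (subst open_subopen, intro ballI)
    fix z assume z: "z \<in> (\<lambda>z. \<phi> z i) -` B"
    obtain K where K: "\<forall>z'\<in>cyl z K. \<phi> z' i = \<phi> z i"
      using assms by blast
    have "cyl z K \<subseteq> (\<lambda>z. \<phi> z i) -` B"
    proof
      fix z' assume "z' \<in> cyl z K"
      with K have "\<phi> z' i = \<phi> z i" by blast
      then show "z' \<in> (\<lambda>z. \<phi> z i) -` B" using z by simp
    qed
    then show "\<exists>T. open T \<and> z \<in> T \<and> T \<subseteq> (\<lambda>z. \<phi> z i) -` B"
      by (intro exI[of _ "cyl z K"] conjI open_cyl cyl_self)
  qed
  then show "continuous_on UNIV (\<lambda>z. \<phi> z i)"
    by (simp add: continuous_on_open_vimage)
qed

text \<open>A point \<open>z\<close> codes a pair \<open>(x, w)\<close>, with \<open>x = first_part z\<close>. The point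
  \<open>second_part g z\<close> is \<open>w\<close> with the first \<open>g n + 1\<close> entries of column \<open>n\<close> erased
  unless \<open>x\<close> vanishes there, so that one of the two points is forced to exceed \<open>g n\<close>. As
  \<open>x\<close> may always be taken to vanish on the remaining columns, \<open>second_part g\<close> still maps
  generic points to generic points.\<close>

definition first_part :: "(nat \<Rightarrow> bool) \<Rightarrow> nat \<Rightarrow> bool" where
  "first_part z i = z (2 * i)"

definition second_part :: "(nat \<Rightarrow> nat) \<Rightarrow> (nat \<Rightarrow> bool) \<Rightarrow> nat \<Rightarrow> bool" where
  "second_part g z i \<longleftrightarrow> z (2 * i + 1) \<and>
     (g (fst (prod_decode i)) < snd (prod_decode i) \<or>
      (\<forall>j\<le>g (fst (prod_decode i)). \<not> z (2 * prod_encode (fst (prod_decode i), j))))"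

lemma first_or_second_part_large:
  "(\<forall>j\<le>g n. \<not> first_part z (prod_encode (n, j))) \<or> (\<forall>j\<le>g n. \<not> second_part g z (prod_encode (n, j)))"
  by (auto simp: first_part_def second_part_def)

lemma nondegenerate_first_part: "nondegenerate first_part"
  unfolding nondegenerate_def
proof (intro conjI allI)
  show "continuous_on UNIV first_part"
  proof (rule continuous_on_cylI)
    fix z i
    show "\<exists>K. \<forall>z'\<in>cyl z K. first_part z' i = first_part z i"
      by (intro exI[of _ "Suc (2 * i)"]) (auto simp: cyl_def first_part_def)
  qed
  fix u :: "nat \<Rightarrow> bool" and K :: nat
  have "cyl (first_part u) K \<subseteq> first_part ` cyl u K"
  proof
    fix x assume x: "x \<in> cyl (first_part u) K"
    let ?z = "\<lambda>k. if k < K then u k else x (k div 2)"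
    have "first_part ?z = x"
      using x by (auto simp: first_part_def cyl_def fun_eq_iff)
    moreover have "?z \<in> cyl u K" by (simp add: cyl_def)
    ultimately show "x \<in> first_part ` cyl u K" by (rule image_eqI[OF sym])
  qed
  then show "\<exists>v L. cyl v L \<subseteq> first_part ` cyl u K" by blast
qed

text \<open>Extend \<open>u\<close> by zeros from \<open>K\<close> on. Then erasure can affect only
  columns below \<open>K\<close>, hence finitely many positions, and the odd coordinates beyond
  these realise arbitrary values.\<close>

lemma nondegenerate_second_part: "nondegenerate (second_part g)"
  unfolding nondegenerate_def
proof (intro conjI allI)
  show "continuous_on UNIV (second_part g)"
  proof (rule continuous_on_cylI)
    fix z i
    let ?n = "fst (prod_decode i)"
    obtain K where K: "\<forall>k\<in>insert (2 * i + 1) ((\<lambda>j. 2 * prod_encode (?n, j)) ` {..g ?n}). k < K"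
      using finite_nat_set_iff_bounded by (metis finite_atMost finite_imageI finite_insert)
    have "second_part g z' i = second_part g z i" if z': "z' \<in> cyl z K" for z'
    proof -
      have "z' (2 * i + 1) = z (2 * i + 1)"
        "\<And>j. j \<le> g ?n \<Longrightarrow> z' (2 * prod_encode (?n, j)) = z (2 * prod_encode (?n, j))"
        using z' K by (auto simp: cyl_def)
      then show ?thesis by (simp add: second_part_def)
    qed
    then show "\<exists>K. \<forall>z'\<in>cyl z K. second_part g z' i = second_part g z i" by blast
  qed
  fix u :: "nat \<Rightarrow> bool" and K :: nat
  define z where "z k \<longleftrightarrow> k < K \<and> u k" for k
  \<comment> \<open>\<open>L\<close> exceeds every position that can be erased in a column below
    \<open>K\<close>.\<close>
  obtain L where L: "\<forall>i\<in>insert K ((\<lambda>(n, j). prod_encode (n, j)) ` (SIGMA n:{..<K}. {..g n})). i < L"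
    using finite_nat_set_iff_bounded
    by (metis finite_SigmaI finite_atMost finite_imageI finite_insert finite_lessThan)
  have "cyl (second_part g z) L \<subseteq> second_part g ` cyl u K"
  proof
    fix y assume y: "y \<in> cyl (second_part g z) L"
    \<comment> \<open>Only odd coordinates change, while the condition for erasure reads even ones
      and so is the same for \<open>?z\<close> as for \<open>z\<close>.\<close>
    let ?z = "\<lambda>k. if odd k \<and> L \<le> k div 2 then y (k div 2) else z k"
    have even: "?z (2 * k) = z (2 * k)" for k by simp
    have "second_part g ?z i = y i" for i
    proof (cases "i < L")
      case True
      then have "second_part g ?z i = second_part g z i"
        by (simp add: second_part_def)
      then show ?thesis using y True by (simp add: cyl_def)
    next
      case False
      define n m where "n = fst (prod_decode i)" and "m = snd (prod_decode i)"
      have i: "i = prod_encode (n, m)" by (simp add: n_def m_def)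
      have "g n < m \<or> K \<le> n"
      proof (rule ccontr)
        assume "\<not> (g n < m \<or> K \<le> n)"
        then have "i \<in> (\<lambda>(n, j). prod_encode (n, j)) ` (SIGMA n:{..<K}. {..g n})"
          by (intro image_eqI[of _ _ "(n, m)"]) (auto simp: i)
        then show False using L False by blast
      qed
      moreover have "\<not> z (2 * prod_encode (n, j))" if "K \<le> n" for j
        using that le_prod_encode_1[of n j] by (simp add: z_def)
      ultimately show ?thesis
        using False by (auto simp: second_part_def i)
    qed
    then have "second_part g ?z = y" by blast
    moreover have "?z \<in> cyl u K"
      using L by (auto simp: cyl_def z_def)
    ultimately show "y \<in> second_part g ` cyl u K" by (rule image_eqI[OF sym])
  qed
  then show "\<exists>v L. cyl v L \<subseteq> second_part g ` cyl u K" by blast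
qed

lemma first_part_surj: "\<exists>z. first_part z = x"
  by (intro exI[of _ "\<lambda>k. x (k div 2)"]) (simp add: first_part_def fun_eq_iff)

lemma second_part_surj: "\<exists>z. second_part g z = x"
  by (intro exI[of _ "\<lambda>k. odd k \<and> x (k div 2)"]) (simp add: second_part_def fun_eq_iff)

section \<open>Generic points outside fewer than continuum many meager sets\<close>

definition cov_meager_continuum :: bool where
  "cov_meager_continuum \<longleftrightarrow> (\<forall>\<M> :: (nat \<Rightarrow> bool) set set.
     (\<forall>M\<in>\<M>. meager M) \<longrightarrow> \<M> \<prec> (UNIV :: nat set set) \<longrightarrow> \<Union>\<M> \<noteq> UNIV)"

text \<open>The hypothesis concerns the whole space. Overwriting the first \<open>K\<close> entries
  by \<open>u\<close> is nondegenerate, so a point outside the preimages of the \<open>M j\<close>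
  is sent to a point of the cylinder outside the \<open>M j\<close>.\<close>

lemma generic_point_in_cyl:
  assumes cov: cov_meager_continuum
    and J: "J \<prec> (UNIV :: nat set set)" and M: "\<And>j. j \<in> J \<Longrightarrow> meager (M j)"
  obtains z where "z \<in> cyl u K" "\<And>j. j \<in> J \<Longrightarrow> z \<notin> M j"
proof -
  define \<phi> where "\<phi> z k = (if k < K then u k else z k)" for z :: "nat \<Rightarrow> bool" and k
  have "nondegenerate \<phi>"
    unfolding nondegenerate_def
  proof (intro conjI allI)
    show "continuous_on UNIV \<phi>"
    proof (rule continuous_on_cylI)
      fix z i
      show "\<exists>K. \<forall>z'\<in>cyl z K. \<phi> z' i = \<phi> z i"
        by (intro exI[of _ "Suc i"]) (auto simp: cyl_def \<phi>_def)
    qed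
    fix u' K'
    have "cyl (\<phi> u') (max K K') \<subseteq> \<phi> ` cyl u' K'"
    proof
      fix y assume y: "y \<in> cyl (\<phi> u') (max K K')"
      let ?z = "\<lambda>k. if k < K' then u' k else y k"
      have "\<phi> ?z = y" using y by (auto simp: cyl_def \<phi>_def fun_eq_iff)
      moreover have "?z \<in> cyl u' K'" by (simp add: cyl_def)
      ultimately show "y \<in> \<phi> ` cyl u' K'" by (rule image_eqI[OF sym])
    qed
    then show "\<exists>v L. cyl v L \<subseteq> \<phi> ` cyl u' K'" by blast
  qed
  then have "\<forall>N\<in>(\<lambda>j. \<phi> -` M j) ` J. meager N"
    using M meager_vimage by blast
  moreover have "(\<lambda>j. \<phi> -` M j) ` J \<prec> (UNIV :: nat set set)"
    using image_lepoll J by (rule lesspoll_trans1)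
  ultimately have "\<Union>((\<lambda>j. \<phi> -` M j) ` J) \<noteq> UNIV"
    using cov unfolding cov_meager_continuum_def by blast
  then obtain z where "\<And>j. j \<in> J \<Longrightarrow> \<phi> z \<notin> M j" by blast
  moreover have "\<phi> z \<in> cyl u K" by (simp add: cyl_def \<phi>_def)
  ultimately show ?thesis using that by blast
qed

lemma infinite_UNIV_nat_set: "infinite (UNIV :: nat set set)"
  by (simp add: Finite_Set.finite_set)

text \<open>Each stage avoids one meager set for every finite set of earlier stages; this bounds
  their number.\<close>

lemma Fpow_lesspoll_continuum:
  assumes "A \<prec> (UNIV :: nat set set)"
  shows "Fpow A \<prec> (UNIV :: nat set set)"
proof (cases "finite A")
  case True
  then have "finite (Fpow A)" by (simp add: Fpow_def)
  then show ?thesis using infinite_UNIV_nat_set by (rule finite_lesspoll_infinite[rotated])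
next
  case False
  then show ?thesis using eqpoll_Fpow assms eq_lesspoll_trans by blast
qed

section \<open>Enumerating the Borel sets along the continuum\<close>

text \<open>Every Borel set has such a code, which reduces counting Borel sets to counting
  codes.\<close>

datatype borel_code = Code_Basic nat | Code_Compl borel_code | Code_Union "nat \<Rightarrow> borel_code"

primrec coded_set :: "borel_code \<Rightarrow> (nat \<Rightarrow> bool) set" where
  "coded_set (Code_Basic m) = basic m"
| "coded_set (Code_Compl c) = - coded_set c"
| "coded_set (Code_Union f) = (\<Union>n. coded_set (f n))"

text \<open>A code is a well-founded countably branching tree; the set of its labelled nodes
  determines it, so there are at most continuum many codes.\<close>

primrec code_tree :: "borel_code \<Rightarrow> (nat list \<times> nat) set" where
  "code_tree (Code_Basic m) = {([], m + 2)}"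
| "code_tree (Code_Compl c) = insert ([], 0) {(0 # p, l) | p l. (p, l) \<in> code_tree c}"
| "code_tree (Code_Union f) = insert ([], 1) {(n # p, l) | n p l. (p, l) \<in> code_tree (f n)}"

text \<open>The label at the root identifies the constructor; labels 0 and 1 are reserved, hence the
  \<open>m + 2\<close> for basic codes. Subtrees are recovered from the first entries of the
  paths.\<close>

lemma code_tree_inject: "code_tree c = code_tree c' \<Longrightarrow> c = c'"
proof (induction c arbitrary: c')
  case (Code_Basic m)
  then have "([], m + 2) \<in> code_tree c'" by auto
  then show ?case by (cases c') auto
next
  case (Code_Compl c)
  then have "([], 0) \<in> code_tree c'" by auto
  then obtain d where d: "c' = Code_Compl d" by (cases c') auto
  have "(p, l) \<in> code_tree c \<longleftrightarrow> (p, l) \<in> code_tree d" for p l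
    using Code_Compl.prems[unfolded d, THEN eqset_imp_iff, of "(0 # p, l)"] by simp
  then have "code_tree c = code_tree d" by auto
  then show ?case using Code_Compl.IH d by blast
next
  case (Code_Union f)
  then have "([], 1) \<in> code_tree c'" by auto
  then obtain d where d: "c' = Code_Union d" by (cases c') auto
  have "(p, l) \<in> code_tree (f n) \<longleftrightarrow> (p, l) \<in> code_tree (d n)" for n p l
    using Code_Union.prems[unfolded d, THEN eqset_imp_iff, of "(n # p, l)"] by simp
  then have "code_tree (f n) = code_tree (d n)" for n by auto
  then have "f n = d n" for n using Code_Union.IH by blast
  then show ?case using d by auto
qed

lemma topological_basis_basic: "topological_basis (range basic)"
proof (rule topological_basisI)
  fix G :: "(nat \<Rightarrow> bool) set" and x assume "open G" "x \<in> G"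
  then obtain K where "cyl x K \<subseteq> G" using open_contains_cyl by blast
  then show "\<exists>B\<in>range basic. x \<in> B \<and> B \<subseteq> G"
    using cyl_eq_basic[of x K] cyl_self[of x K] by (metis rangeI)
qed (auto intro: open_basic)

lemma borel_eq_range_coded_set: "sets borel = range coded_set"
proof
  have "coded_set c \<in> sets borel" for c
    by (induction c) (auto simp: open_basic)
  then show "range coded_set \<subseteq> sets borel" by blast
  have *: "borel = sigma UNIV (range basic)"
    by (rule borel_eq_countable_basis) (auto simp: topological_basis_basic)
  have "sets borel = sigma_sets UNIV (range basic)"
    unfolding * by (rule sets_measure_of) simp
  moreover have "A \<in> range coded_set" if "A \<in> sigma_sets UNIV (range basic)" for A
    using that
  proof induction
    case (Basic a)
    then show ?case by (metis coded_set.simps(1) imageE rangeI)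
  next
    case Empty
    \<comment> \<open>The empty string stands for the whole space.\<close>
    have "coded_set (Code_Compl (Code_Basic (to_nat ([] :: bool list)))) = {}"
      by (simp add: basic_def cyl_def)
    then show ?case by (metis rangeI)
  next
    case (Compl a)
    then obtain c where "a = coded_set c" by blast
    then have "UNIV - a = coded_set (Code_Compl c)" by auto
    then show ?case by blast
  next
    case (Union a)
    then have "\<forall>n. \<exists>c. a n = coded_set c" by blast
    then obtain f where "\<And>n. a n = coded_set (f n)" by metis
    then have "(\<Union>n. a n) = coded_set (Code_Union f)" by auto
    then show ?case by blast
  qed
  ultimately show "sets borel \<subseteq> range coded_set" by blast
qed

text \<open>Every triple occurs at continuum many indices, hence not only before a given stage; the
  density of the constructed sets rests on this. The repetition comes from the dummy set
  \<open>S\<close> in \<open>\<Phi>\<close>.\<close>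

lemma enumeration_of_parameters:
  obtains E :: "nat set \<Rightarrow> nat \<Rightarrow> nat \<Rightarrow> (nat \<Rightarrow> bool) set"
    and g :: "nat set \<Rightarrow> nat \<Rightarrow> nat" and w :: "nat set \<Rightarrow> nat"
  where "\<And>\<alpha> n k. E \<alpha> n k \<in> sets borel"
    and "\<And>E' g' w'. (\<And>n k. E' n k \<in> sets borel) \<Longrightarrow>
           (UNIV :: nat set set) \<lesssim> {\<alpha>. E \<alpha> = E' \<and> g \<alpha> = g' \<and> w \<alpha> = w'}"
proof -
  \<comment> \<open>The tags 0 to 3 keep the four components apart inside one countable type, which
    \<open>to_nat\<close> carries into the natural numbers.\<close>
  define \<Phi> :: "(nat \<Rightarrow> nat \<Rightarrow> borel_code) \<times> (nat \<Rightarrow> nat) \<times> nat \<times> nat set \<Rightarrow> nat set"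
    where "\<Phi> = (\<lambda>(c, g, w, S). to_nat ` (
      {(0 :: nat, [n, k, l], p) | n k p l. (p, l) \<in> code_tree (c n k)} \<union>
      {(1, [n], [g n]) | n. True} \<union> {(2, [w], [])} \<union> {(3, [s], []) | s. s \<in> S}))"
  have inj: "inj \<Phi>"
  proof (rule injI)
    fix x x' assume eq: "\<Phi> x = \<Phi> x'"
    obtain c g w S c' g' w' S' where x: "x = (c, g, w, S)" "x' = (c', g', w', S')"
      by (metis prod.exhaust)
    have eq': "{(0 :: nat, [n, k, l], p) | n k p l. (p, l) \<in> code_tree (c n k)} \<union>
      {(1, [n], [g n]) | n. True} \<union> {(2, [w], [])} \<union> {(3, [s], []) | s. s \<in> S} =
      {(0 :: nat, [n, k, l], p) | n k p l. (p, l) \<in> code_tree (c' n k)} \<union>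
      {(1, [n], [g' n]) | n. True} \<union> {(2, [w'], [])} \<union> {(3, [s], []) | s. s \<in> S'}" (is "?L = ?R")
      using eq unfolding x \<Phi>_def by (simp add: inj_image_eq_iff[OF inj_to_nat] del: Un_insert_left Un_insert_right)
    have "(p, l) \<in> code_tree (c n k) \<longleftrightarrow> (p, l) \<in> code_tree (c' n k)" for p l n k
      using eqset_imp_iff[OF eq', of "(0, [n, k, l], p)"] by simp
    then have "c n k = c' n k" for n k
      by (intro code_tree_inject) auto
    moreover have "g n = g' n" for n
      using eqset_imp_iff[OF eq', of "(1, [n], [g n])"] by simp
    moreover have "w = w'"
      using eqset_imp_iff[OF eq', of "(2, [w], [])"] by simp
    moreover have "s \<in> S \<longleftrightarrow> s \<in> S'" for s
      using eqset_imp_iff[OF eq', of "(3, [s], [])"] by simp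
    ultimately show "x = x'" by (auto simp: x)
  qed
  \<comment> \<open>At indices outside the range of \<open>\<Phi>\<close> the value of
    \<open>D\<close> is an arbitrary tuple, still made of codes, so \<open>E\<close> is Borel at
    every index.\<close>
  define D where "D = inv_into UNIV \<Phi>"
  have D: "D (\<Phi> x) = x" for x
    by (simp add: D_def inj)
  define E where "E \<alpha> n k = coded_set (fst (D \<alpha>) n k)" for \<alpha> n k
  define g where "g \<alpha> = fst (snd (D \<alpha>))" for \<alpha>
  define w where "w \<alpha> = fst (snd (snd (D \<alpha>)))" for \<alpha>
  have "(UNIV :: nat set set) \<lesssim> {\<alpha>. E \<alpha> = E' \<and> g \<alpha> = g' \<and> w \<alpha> = w'}"
    if "\<And>n k. E' n k \<in> sets borel" for E' g' w'
  proof -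
    have "\<forall>n k. \<exists>c. E' n k = coded_set c"
      using that unfolding borel_eq_range_coded_set by blast
    then obtain c where c: "\<And>n k. E' n k = coded_set (c n k)" by metis
    have "inj (\<lambda>S. \<Phi> (c, g', w', S))"
      using inj by (auto simp: inj_def)
    moreover have "range (\<lambda>S. \<Phi> (c, g', w', S)) \<subseteq> {\<alpha>. E \<alpha> = E' \<and> g \<alpha> = g' \<and> w \<alpha> = w'}"
      by (auto simp: E_def g_def w_def D c fun_eq_iff)
    ultimately show ?thesis unfolding lepoll_def by blast
  qed
  moreover have "E \<alpha> n k \<in> sets borel" for \<alpha> n k
    by (simp add: E_def borel_eq_range_coded_set)
  ultimately show ?thesis using that by blast
qed

section \<open>The transfinite construction\<close>

text \<open>The type \<open>nat set\<close> serves both as the continuum and as the index set of the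
  recursion. Its cardinal order has only initial segments of smaller size.\<close>

abbreviation continuum_order :: "nat set rel" where
  "continuum_order \<equiv> card_of (UNIV :: nat set set)"

abbreviation below :: "nat set \<Rightarrow> nat set set" where
  "below \<alpha> \<equiv> underS continuum_order \<alpha>"

lemma below_lesspoll: "below \<alpha> \<prec> (UNIV :: nat set set)"
proof -
  have "card_of (below \<alpha>) <o continuum_order"
    by (rule card_of_underS) (auto simp: card_of_Card_order)
  then have "\<not> below \<alpha> \<approx> (UNIV :: nat set set)"
    unfolding eqpoll_iff_card_of_ordIso using not_ordLess_ordIso by blast
  then show ?thesis
    by (simp add: lesspoll_def subset_imp_lepoll)
qed

lemma wf_below: "wf {(\<beta>, \<alpha>). \<beta> \<in> below \<alpha>}"
proof -
  have "{(\<beta>, \<alpha>). \<beta> \<in> below \<alpha>} = continuum_order - Id"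
    by (auto simp: underS_def)
  then show ?thesis
    using card_of_Well_order[of "UNIV :: nat set set"] by (simp add: well_order_on_def)
qed

lemma below_total: "\<alpha> \<in> below \<beta> \<or> \<alpha> = \<beta> \<or> \<beta> \<in> below \<alpha>"
proof -
  have "total_on UNIV continuum_order"
    using card_of_well_order_on[of "UNIV :: nat set set"]
    by (simp add: well_order_on_def linear_order_on_def)
  then show ?thesis by (auto simp: total_on_def underS_def)
qed

lemma below_trans: "\<alpha> \<in> below \<beta> \<Longrightarrow> \<beta> \<in> below \<gamma> \<Longrightarrow> \<alpha> \<in> below \<gamma>"
proof -
  have "trans continuum_order" "antisym continuum_order"
    using card_of_well_order_on[of "UNIV :: nat set set"]
    by (simp_all add: well_order_on_def linear_order_on_def partial_order_on_def preorder_on_def)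
  then show "\<alpha> \<in> below \<beta> \<Longrightarrow> \<beta> \<in> below \<gamma> \<Longrightarrow> \<alpha> \<in> below \<gamma>"
    unfolding underS_def by (auto dest: transD antisymD)
qed

lemma finite_has_greatest:
  assumes "finite A" "A \<noteq> {}"
  shows "\<exists>\<alpha>\<in>A. A - {\<alpha>} \<subseteq> below \<alpha>"
  using assms
proof (induction rule: finite_ne_induct)
  case (insert \<beta> A)
  then obtain \<alpha> where \<alpha>: "\<alpha> \<in> A" "A - {\<alpha>} \<subseteq> below \<alpha>" by blast
  have "\<beta> \<noteq> \<alpha>" using insert.hyps \<alpha>(1) by blast
  then consider "\<beta> \<in> below \<alpha>" | "\<alpha> \<in> below \<beta>"
    using below_total by blast
  then show ?case
  proof cases
    case 1
    then show ?thesis using \<alpha> by blast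
  next
    case 2
    then have "A \<subseteq> below \<beta>" using \<alpha> below_trans by blast
    then show ?thesis by blast
  qed
qed simp

text \<open>What stage \<open>\<alpha>\<close> has to achieve: \<open>p i \<gamma>\<close> is the point put into the \<open>i\<close>-th set at
  stage \<open>\<gamma>\<close>, and \<open>S \<gamma>\<close> is the sequence selected from \<open>E \<gamma>\<close>.\<close>

definition stage_ok where
  "stage_ok E N p S \<alpha> \<longleftrightarrow>
     (\<forall>i :: bool. p i \<alpha> \<notin> N \<and>
       (\<forall>D. finite D \<and> D \<subseteq> below \<alpha> \<longrightarrow>
         ((\<forall>n. good (p i ` D) (E \<alpha> n)) \<longrightarrow> good (p i ` D) (S \<alpha>)) \<and>
         (\<forall>\<beta>\<in>insert \<alpha> D.
           (\<forall>n k m. meager (E \<beta> n k \<inter> basic m) \<longrightarrow> p i \<alpha> \<notin> E \<beta> n k \<inter> basic m) \<and>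
           (\<forall>A\<subseteq>D. good (p i ` A) (S \<beta>) \<longrightarrow> good (insert (p i \<alpha>) (p i ` A)) (S \<beta>)))))"

text \<open>In \<open>stage_ok\<close> all requirements are indexed by one finite set
  \<open>D\<close>, to fit an avoidance argument over \<open>Fpow\<close>. They are separated here,
  with \<open>\<beta>\<close> adjoined to \<open>D\<close> where necessary.\<close>

lemma stage_okD:
  assumes "stage_ok E N p S \<alpha>"
  shows "p i \<alpha> \<notin> N"
    and "finite D \<Longrightarrow> D \<subseteq> below \<alpha> \<Longrightarrow> (\<And>n. good (p i ` D) (E \<alpha> n)) \<Longrightarrow> good (p i ` D) (S \<alpha>)"
    and "\<beta> \<in> insert \<alpha> (below \<alpha>) \<Longrightarrow> meager (E \<beta> n k \<inter> basic m) \<Longrightarrow> p i \<alpha> \<notin> E \<beta> n k \<inter> basic m"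
    and "finite D \<Longrightarrow> D \<subseteq> below \<alpha> \<Longrightarrow> \<beta> \<in> insert \<alpha> (below \<alpha>) \<Longrightarrow> good (p i ` D) (S \<beta>) \<Longrightarrow>
           good (insert (p i \<alpha>) (p i ` D)) (S \<beta>)"
proof -
  note ok = assms[unfolded stage_ok_def, THEN spec, of i]
  note ok' = ok[THEN conjunct2, THEN spec, THEN mp, OF conjI]
  show "p i \<alpha> \<notin> N" using ok by (rule conjunct1)
  show "good (p i ` D) (S \<alpha>)" if "finite D" "D \<subseteq> below \<alpha>" "\<And>n. good (p i ` D) (E \<alpha> n)"
    using ok'[OF that(1,2), THEN conjunct1] that(3) by (simp only: simp_thms)
  show "p i \<alpha> \<notin> E \<beta> n k \<inter> basic m" if "\<beta> \<in> insert \<alpha> (below \<alpha>)" "meager (E \<beta> n k \<inter> basic m)"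
  proof -
    have "finite ({\<beta>} - {\<alpha>})" "{\<beta>} - {\<alpha>} \<subseteq> below \<alpha>" "\<beta> \<in> insert \<alpha> ({\<beta>} - {\<alpha>})"
      using that(1) by auto
    from ok'[OF this(1,2), THEN conjunct2, THEN bspec, OF this(3), THEN conjunct1]
    show ?thesis using that(2) by blast
  qed
  show "good (insert (p i \<alpha>) (p i ` D)) (S \<beta>)"
    if "finite D" "D \<subseteq> below \<alpha>" "\<beta> \<in> insert \<alpha> (below \<alpha>)" "good (p i ` D) (S \<beta>)"
  proof -
    have "finite (D \<union> ({\<beta>} - {\<alpha>}))" "D \<union> ({\<beta>} - {\<alpha>}) \<subseteq> below \<alpha>"
      "\<beta> \<in> insert \<alpha> (D \<union> ({\<beta>} - {\<alpha>}))"
      using that by auto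
    from ok'[OF this(1,2), THEN conjunct2, THEN bspec, OF this(3), THEN conjunct2]
    show ?thesis using that(4) by (simp only: Un_upper1 simp_thms)
  qed
qed

text \<open>Stage \<open>\<alpha>\<close> looks only at values up to \<open>\<alpha>\<close>, as the
  well-founded recursion requires.\<close>

lemma stage_ok_cong:
  assumes p: "\<And>i \<gamma>. \<gamma> \<in> insert \<alpha> (below \<alpha>) \<Longrightarrow> p i \<gamma> = p' i \<gamma>"
    and S: "\<And>\<gamma>. \<gamma> \<in> insert \<alpha> (below \<alpha>) \<Longrightarrow> S \<gamma> = S' \<gamma>"
    and ok: "stage_ok E N p S \<alpha>"
  shows "stage_ok E N p' S' \<alpha>"
  unfolding stage_ok_def
proof (intro allI conjI impI ballI; (elim conjE)?)
  fix i show "p' i \<alpha> \<notin> N" using stage_okD(1)[OF ok, of i] p[of \<alpha> i] by simp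
next
  fix i D assume D: "finite D" "D \<subseteq> below \<alpha>"
  have im: "p' i ` A = p i ` A" if "A \<subseteq> D" for A
    using D(2) that p by (intro image_cong) auto
  {
    assume "\<forall>n. good (p' i ` D) (E \<alpha> n)"
    then show "good (p' i ` D) (S' \<alpha>)"
      using stage_okD(2)[OF ok D, of i] im[of D] S[of \<alpha>] by simp
  next
    fix \<beta> n k m assume "\<beta> \<in> insert \<alpha> D" "meager (E \<beta> n k \<inter> basic m)"
    then show "p' i \<alpha> \<notin> E \<beta> n k \<inter> basic m"
      using stage_okD(3)[OF ok, of \<beta> n k m i] D(2) p[of \<alpha> i] by auto
  next
    fix \<beta> A assume \<beta>: "\<beta> \<in> insert \<alpha> D" and A: "A \<subseteq> D" and "good (p' i ` A) (S' \<beta>)"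
    moreover have \<beta>': "\<beta> \<in> insert \<alpha> (below \<alpha>)" using \<beta> D(2) by blast
    ultimately have "good (p i ` A) (S \<beta>)" using im S[of \<beta>] by simp
    moreover have "finite A" "A \<subseteq> below \<alpha>" using A D finite_subset by auto
    ultimately have "good (insert (p i \<alpha>) (p i ` A)) (S \<beta>)"
      using stage_okD(4)[OF ok _ _ \<beta>'] by blast
    then show "good (insert (p' i \<alpha>) (p' i ` A)) (S' \<beta>)"
      using p[of \<alpha> i] im[OF A] S[OF \<beta>'] by simp
  }
qed

text \<open>Two successive generic choices: first \<open>b\<close>, relative to the points already
  present, then \<open>z\<close>, whose points must preserve the goodness of the new selection as
  well as that of the earlier ones.\<close>

lemma stage_exists:
  fixes \<psi> :: "bool \<Rightarrow> (nat \<Rightarrow> bool) \<Rightarrow> nat \<Rightarrow> bool"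
  assumes cov: cov_meager_continuum
    and E: "\<And>\<alpha> n k. E \<alpha> n k \<in> sets borel" and \<psi>: "\<And>i. nondegenerate (\<psi> i)" and N: "meager N"
    and S: "\<And>\<beta> n. S \<beta> n \<in> sets borel"
  shows "\<exists>b z. z \<in> basic m \<and>
    stage_ok E N (\<lambda>i. (p i)(\<alpha> := \<psi> i z)) (S(\<alpha> := \<lambda>n. E \<alpha> n (select b n))) \<alpha>"
proof -
  have small: "Fpow (below \<alpha>) \<prec> (UNIV :: nat set set)"
    by (intro Fpow_lesspoll_continuum below_lesspoll)
  define MB where "MB D = (\<Union>i\<in>{i. \<forall>n. good (p i ` D) (E \<alpha> n)}.
      {b. \<not> good (p i ` D) (\<lambda>n. E \<alpha> n (select b n))})" for D
  have "meager (MB D)" for D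
    unfolding MB_def by (intro meager_UN) (auto intro: meager_not_good_select)
  then obtain b where b: "\<And>D. D \<in> Fpow (below \<alpha>) \<Longrightarrow> b \<notin> MB D"
    using generic_point_in_cyl[OF cov small] by metis
  define S' where "S' = S(\<alpha> := \<lambda>n. E \<alpha> n (select b n))"
  have S': "S' \<beta> n \<in> sets borel" for \<beta> n
    using E S by (simp add: S'_def)
  define K where "K \<beta> = (\<Union>(n, k, m)\<in>{(n, k, m). meager (E \<beta> n k \<inter> basic m)}. E \<beta> n k \<inter> basic m)" for \<beta>
  have K: "meager (K \<beta>)" for \<beta>
    unfolding K_def by (intro meager_UN) auto
  define G where "G i D \<beta> = (\<Union>A\<in>{A. A \<subseteq> D \<and> good (p i ` A) (S' \<beta>)}.
      {x. \<not> good (insert x (p i ` A)) (S' \<beta>)})" for i D \<beta>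
  have G: "meager (G i D \<beta>)" if "finite D" for i D \<beta>
    unfolding G_def
  proof (intro meager_UN)
    show "countable {A. A \<subseteq> D \<and> good (p i ` A) (S' \<beta>)}"
      using that by (intro countable_finite) simp
  qed (auto intro: meager_not_good_insert S')
  \<comment> \<open>Both points come from the same \<open>z\<close>, so what they must avoid is
    pulled back along \<open>\<psi> i\<close> and united over the two values of
    \<open>i\<close>.\<close>
  define MZ where "MZ D = (\<Union>i. \<psi> i -` (N \<union> (\<Union>\<beta>\<in>insert \<alpha> D. K \<beta> \<union> G i D \<beta>)))" for D
  have MZ: "meager (MZ D)" if "D \<in> Fpow (below \<alpha>)" for D
  proof -
    have "finite D" using that by (simp add: Fpow_def)
    then show ?thesis
      unfolding MZ_def
      by (intro meager_UN[of UNIV] meager_UN[of "insert \<alpha> D"] meager_vimage meager_Un N K G \<psi> countableI_type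
          countable_finite finite.insertI) auto
  qed
  obtain u L where uL: "basic m = cyl u L" using basic_eq_cyl by blast
  obtain z where z: "z \<in> basic m" "\<And>D. D \<in> Fpow (below \<alpha>) \<Longrightarrow> z \<notin> MZ D"
    using generic_point_in_cyl[where u=u and K=L and M=MZ, OF cov small MZ] unfolding uL by blast
  define p' where "p' i = (p i)(\<alpha> := \<psi> i z)" for i
  have "stage_ok E N p' S' \<alpha>"
    unfolding stage_ok_def
  proof (intro allI conjI impI ballI; (elim conjE)?)
    fix i
    have "z \<notin> MZ {}" using z(2) by (simp add: empty_in_Fpow)
    then show "p' i \<alpha> \<notin> N" unfolding MZ_def p'_def by auto
  next
    fix i D assume D: "finite D" "D \<subseteq> below \<alpha>"
    then have DF: "D \<in> Fpow (below \<alpha>)" by (simp add: Fpow_def)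
    have im: "p' i ` A = p i ` A" if "A \<subseteq> D" for A
      using that D(2) by (intro image_cong) (auto simp: p'_def underS_def)
    have zD: "\<psi> i z \<notin> K \<beta> \<union> G i D \<beta>" if "\<beta> \<in> insert \<alpha> D" for \<beta>
      using z(2)[OF DF] that unfolding MZ_def by blast
    have p'\<alpha>: "p' i \<alpha> = \<psi> i z" by (simp add: p'_def)
    {
      assume "\<forall>n. good (p' i ` D) (E \<alpha> n)"
      then show "good (p' i ` D) (S' \<alpha>)"
        using b[OF DF] im[of D] unfolding MB_def S'_def by auto
    next
      fix \<beta> n k m assume "\<beta> \<in> insert \<alpha> D" "meager (E \<beta> n k \<inter> basic m)"
      then show "p' i \<alpha> \<notin> E \<beta> n k \<inter> basic m"
        using zD unfolding p'\<alpha> K_def by blast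
    next
      fix \<beta> A assume "\<beta> \<in> insert \<alpha> D" "A \<subseteq> D" "good (p' i ` A) (S' \<beta>)"
      then show "good (insert (p' i \<alpha>) (p' i ` A)) (S' \<beta>)"
        using zD[of \<beta>] im[of A] unfolding p'\<alpha> G_def by auto
    }
  qed
  then show ?thesis using z(1) unfolding p'_def S'_def by blast
qed

lemma generic_construction:
  fixes \<psi> :: "bool \<Rightarrow> nat set \<Rightarrow> (nat \<Rightarrow> bool) \<Rightarrow> nat \<Rightarrow> bool"
  assumes cov: cov_meager_continuum
    and E: "\<And>\<alpha> n k. E \<alpha> n k \<in> sets borel" and \<psi>: "\<And>i \<alpha>. nondegenerate (\<psi> i \<alpha>)" and N: "meager N"
  obtains b z where "\<And>\<alpha>. z \<alpha> \<in> basic (w \<alpha>)"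
    "\<And>\<alpha>. stage_ok E N (\<lambda>i \<gamma>. \<psi> i \<gamma> (z \<gamma>)) (\<lambda>\<gamma> n. E \<gamma> n (select (b \<gamma>) n)) \<alpha>"
proof -
  define p where "p h i \<gamma> = \<psi> i \<gamma> (snd (h \<gamma>))" for h :: "nat set \<Rightarrow> (nat \<Rightarrow> bool) \<times> (nat \<Rightarrow> bool)" and i \<gamma>
  define S where "S h \<gamma> n = E \<gamma> n (select (fst (h \<gamma>)) n)" for h :: "nat set \<Rightarrow> (nat \<Rightarrow> bool) \<times> (nat \<Rightarrow> bool)" and \<gamma> n
  \<comment> \<open>Overriding \<open>h\<close> at \<open>\<alpha>\<close> by the candidate
    \<open>y\<close> expresses the condition through \<open>stage_ok\<close>; by
    \<open>stage_ok_cong\<close> it depends on \<open>h\<close> only below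
    \<open>\<alpha>\<close>.\<close>
  define P where "P h \<alpha> y \<longleftrightarrow> snd y \<in> basic (w \<alpha>) \<and> stage_ok E N (p (h(\<alpha> := y))) (S (h(\<alpha> := y))) \<alpha>" for h \<alpha> y
  have P_cong: "P h \<alpha> y" if "P h' \<alpha> y" "\<And>\<gamma>. \<gamma> \<in> below \<alpha> \<Longrightarrow> h \<gamma> = h' \<gamma>" for h h' \<alpha> y
    unfolding P_def
  proof
    show "snd y \<in> basic (w \<alpha>)" using that(1) by (simp add: P_def)
    show "stage_ok E N (p (h(\<alpha> := y))) (S (h(\<alpha> := y))) \<alpha>"
      by (rule stage_ok_cong[where p="p (h'(\<alpha> := y))" and S="S (h'(\<alpha> := y))"])
        (use that in \<open>auto simp: P_def p_def S_def fun_eq_iff\<close>)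
  qed
  have "\<exists>h. \<forall>\<alpha>. P h \<alpha> (h \<alpha>)"
  proof (rule dependent_wf_choice[OF wf_below])
    fix h h' :: "nat set \<Rightarrow> (nat \<Rightarrow> bool) \<times> (nat \<Rightarrow> bool)" and \<alpha> y
    assume "\<And>\<gamma>. (\<gamma>, \<alpha>) \<in> {(\<beta>, \<alpha>). \<beta> \<in> below \<alpha>} \<Longrightarrow> h \<gamma> = h' \<gamma>"
    then have "\<And>\<gamma>. \<gamma> \<in> below \<alpha> \<Longrightarrow> h \<gamma> = h' \<gamma>" by simp
    then show "P h \<alpha> y = P h' \<alpha> y" using P_cong by metis
  next
    fix \<alpha> and h :: "nat set \<Rightarrow> (nat \<Rightarrow> bool) \<times> (nat \<Rightarrow> bool)"
    have "\<And>\<beta> n. S h \<beta> n \<in> sets borel" by (simp add: S_def E)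
    from stage_exists[where \<alpha>=\<alpha> and \<psi>="\<lambda>i. \<psi> i \<alpha>" and m="w \<alpha>" and p="p h" and S="S h" and E=E, OF cov E \<psi> N this]
    obtain b z where bz: "z \<in> basic (w \<alpha>)"
      "stage_ok E N (\<lambda>i. (p h i)(\<alpha> := \<psi> i \<alpha> z)) ((S h)(\<alpha> := \<lambda>n. E \<alpha> n (select b n))) \<alpha>"
      by blast
    moreover have "(\<lambda>i. (p h i)(\<alpha> := \<psi> i \<alpha> z)) = p (h(\<alpha> := (b, z)))"
      "(S h)(\<alpha> := \<lambda>n. E \<alpha> n (select b n)) = S (h(\<alpha> := (b, z)))"
      by (auto simp: p_def S_def fun_eq_iff)
    ultimately have "P h \<alpha> (b, z)" by (simp add: P_def)
    then show "\<exists>y. P h \<alpha> y" by blast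
  qed
  then obtain h where h: "\<And>\<alpha>. P h \<alpha> (h \<alpha>)" by blast
  have "stage_ok E N (\<lambda>i \<gamma>. \<psi> i \<gamma> (snd (h \<gamma>))) (\<lambda>\<gamma> n. E \<gamma> n (select (fst (h \<gamma>)) n)) \<alpha>" for \<alpha>
    using h[of \<alpha>] unfolding P_def p_def S_def by simp
  moreover have "snd (h \<alpha>) \<in> basic (w \<alpha>)" for \<alpha>
    using h[of \<alpha>] by (simp add: P_def)
  ultimately show ?thesis
    using that[of "\<lambda>\<alpha>. snd (h \<alpha>)" "\<lambda>\<alpha>. fst (h \<alpha>)"] by blast
qed

text \<open>If \<open>A\<close> lies before stage \<open>\<beta>\<close>, the selection was made
  good for it. Otherwise the greatest stage in \<open>A\<close> is \<open>\<beta>\<close> or later,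
  and its point preserves the goodness known by induction for the others.\<close>

lemma good_selected:
  assumes ok: "\<And>\<alpha>. stage_ok E N p S \<alpha>"
    and E: "\<And>A n. finite A \<Longrightarrow> good (p i ` A) (E \<beta> n)"
    and "finite A"
  shows "good (p i ` A) (S \<beta>)"
  using \<open>finite A\<close>
proof (induction A rule: finite_psubset_induct)
  case (psubset A)
  show ?case
  proof (cases "A \<subseteq> below \<beta>")
    case True
    then show ?thesis using stage_okD(2)[OF ok] psubset.hyps E by blast
  next
    case False
    then have "A \<noteq> {}" by blast
    then obtain \<alpha> where \<alpha>: "\<alpha> \<in> A" "A - {\<alpha>} \<subseteq> below \<alpha>"
      using finite_has_greatest psubset.hyps by blast
    have \<beta>: "\<beta> \<in> insert \<alpha> (below \<alpha>)"
    proof (rule ccontr)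
      assume "\<beta> \<notin> insert \<alpha> (below \<alpha>)"
      then have "\<alpha> \<in> below \<beta>" using below_total by blast
      then show False using False \<alpha>(2) below_trans by blast
    qed
    have "good (p i ` (A - {\<alpha>})) (S \<beta>)"
      using psubset.IH[of "A - {\<alpha>}"] \<alpha>(1) by blast
    then have "good (insert (p i \<alpha>) (p i ` (A - {\<alpha>}))) (S \<beta>)"
      using stage_okD(4)[OF ok _ \<alpha>(2) \<beta>] psubset.hyps by blast
    then show ?thesis
      using \<alpha>(1) by (metis image_insert insert_Diff)
  qed
qed

section \<open>Embedding into the real line\<close>

text \<open>This is 3/2 times the usual map onto the middle-thirds Cantor set: the digits are 0 and
  1, and the exponents start at 0.\<close>

definition cantor_map :: "(nat \<Rightarrow> bool) \<Rightarrow> real" where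
  "cantor_map b = suminf (\<lambda>k. of_bool (b k) / 3 ^ k)"

lemma summable_cantor_map: "summable (\<lambda>k. of_bool (b k) / 3 ^ k :: real)"
  by (rule summable_comparison_test[OF _ summable_geometric[of "1/3"]])
    (auto simp: power_divide)

lemma cantor_map_rec: "cantor_map b = of_bool (b 0) + cantor_map (\<lambda>k. b (Suc k)) / 3"
proof -
  have "suminf (\<lambda>k. of_bool (b (Suc k)) / 3 ^ Suc k :: real) = cantor_map b - of_bool (b 0)"
    using suminf_split_head[OF summable_cantor_map[of b]] by (simp add: cantor_map_def)
  moreover have "suminf (\<lambda>k. of_bool (b (Suc k)) / 3 ^ Suc k :: real) = cantor_map (\<lambda>k. b (Suc k)) / 3"
    using suminf_divide[OF summable_cantor_map[of "\<lambda>k. b (Suc k)"], of 3] by (simp add: cantor_map_def mult.commute)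
  ultimately show ?thesis by simp
qed

lemma cantor_map_bounds: "0 \<le> cantor_map b" "cantor_map b \<le> 3 / 2"
proof -
  show "0 \<le> cantor_map b"
    unfolding cantor_map_def by (rule suminf_nonneg[OF summable_cantor_map]) simp
  have "cantor_map b \<le> suminf (\<lambda>k. (1 / 3) ^ k)"
    unfolding cantor_map_def
    by (rule suminf_le[OF _ summable_cantor_map summable_geometric]) (auto simp: power_divide)
  also have "\<dots> = 3 / 2" by (simp add: suminf_geometric)
  finally show "cantor_map b \<le> 3 / 2" .
qed

lemma cantor_map_diff_tails:
  "b 0 = b' 0 \<Longrightarrow>
    \<bar>cantor_map b - cantor_map b'\<bar> = \<bar>cantor_map (\<lambda>k. b (Suc k)) - cantor_map (\<lambda>k. b' (Suc k))\<bar> / 3"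
  using cantor_map_rec[of b] cantor_map_rec[of b'] by (simp flip: diff_divide_distrib)

lemma cantor_map_close: "\<forall>k<K. b k = b' k \<Longrightarrow> \<bar>cantor_map b - cantor_map b'\<bar> \<le> 3 / 2 / 3 ^ K"
proof (induction K arbitrary: b b')
  case 0
  then show ?case using cantor_map_bounds[of b] cantor_map_bounds[of b'] by (auto simp: abs_if)
next
  case (Suc K)
  then have *: "\<bar>cantor_map (\<lambda>k. b (Suc k)) - cantor_map (\<lambda>k. b' (Suc k))\<bar> \<le> 3 / 2 / 3 ^ K" "b 0 = b' 0"
    by auto
  show ?case
    unfolding cantor_map_diff_tails[of b b', OF *(2)] using *(1) by (simp add: field_simps)
qed

text \<open>Distinct leading digits contribute 1, of which the tails can cancel at most (3/2)/3 =
  1/2. Removing an agreeing leading digit multiplies the distance by 3.\<close>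

lemma cantor_map_separates:
  "\<bar>cantor_map b - cantor_map b'\<bar> < 1 / 2 / 3 ^ K \<Longrightarrow> k \<le> K \<Longrightarrow> b k = b' k"
proof (induction K arbitrary: b b' k)
  case 0
  then show ?case
    using cantor_map_rec[of b] cantor_map_rec[of b'] cantor_map_bounds[of "\<lambda>k. b (Suc k)"] cantor_map_bounds[of "\<lambda>k. b' (Suc k)"]
    by (cases "b 0"; cases "b' 0") auto
next
  case (Suc K)
  have "(1 :: real) \<le> 3 ^ Suc K" by (rule one_le_power) simp
  then have "1 / 2 / 3 ^ Suc K \<le> (1 / 2 :: real)" by (simp add: field_simps)
  with Suc.prems(1) have "\<bar>cantor_map b - cantor_map b'\<bar> < 1 / 2" by linarith
  then have 0: "b 0 = b' 0"
    using cantor_map_rec[of b] cantor_map_rec[of b'] cantor_map_bounds[of "\<lambda>k. b (Suc k)"]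
      cantor_map_bounds[of "\<lambda>k. b' (Suc k)"]
    by (cases "b 0"; cases "b' 0") auto
  have "\<bar>cantor_map (\<lambda>k. b (Suc k)) - cantor_map (\<lambda>k. b' (Suc k))\<bar> < 1 / 2 / 3 ^ K"
    using Suc.prems(1) unfolding cantor_map_diff_tails[of b b', OF 0] by (simp add: field_simps)
  then have "b (Suc j) = b' (Suc j)" if "j \<le> K" for j
    using Suc.IH that by blast
  then show ?case using 0 Suc.prems(2) by (cases k) auto
qed

lemma inj_cantor_map: "inj cantor_map"
proof (rule injI)
  fix b b' assume "cantor_map b = cantor_map b'"
  then show "b = b'" using cantor_map_separates[of b b'] by (auto simp: fun_eq_iff)
qed

lemma continuous_cantor_map: "continuous_on UNIV cantor_map"
proof -
  have "open (cantor_map -` B)" if "open B" for B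
  proof (subst open_subopen, intro ballI)
    fix b assume "b \<in> cantor_map -` B"
    then obtain e where e: "e > 0" "ball (cantor_map b) e \<subseteq> B"
      using \<open>open B\<close> open_contains_ball by (metis vimageD)
    obtain K where "(1 / 3) ^ K < e / 2"
      using real_arch_pow_inv[of "e / 2" "1 / 3"] e(1) by auto
    then have K: "3 / 2 / 3 ^ K < e"
      by (simp add: field_simps)
    have "cyl b K \<subseteq> cantor_map -` B"
    proof
      fix x assume "x \<in> cyl b K"
      then have "\<bar>cantor_map b - cantor_map x\<bar> \<le> 3 / 2 / 3 ^ K"
        by (intro cantor_map_close) (simp add: cyl_def)
      then have "cantor_map x \<in> ball (cantor_map b) e" using K by (simp add: dist_real_def)
      then show "x \<in> cantor_map -` B" using e(2) by blast
    qed
    then show "\<exists>T. open T \<and> b \<in> T \<and> T \<subseteq> cantor_map -` B"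
      by (intro exI[of _ "cyl b K"] conjI open_cyl cyl_self)
  qed
  then show ?thesis by (simp add: continuous_on_open_vimage)
qed

text \<open>Sufficiently close image points share their first digits, so the inverse of the
  embedding is continuous on the image.\<close>

lemma openin_cantor_map_image:
  assumes "open G"
  shows "openin (top_of_set (cantor_map ` Y)) (cantor_map ` (Y \<inter> G))"
  unfolding openin_euclidean_subtopology_iff
proof (intro conjI ballI)
  fix r assume "r \<in> cantor_map ` (Y \<inter> G)"
  then obtain y where y: "y \<in> G" "r = cantor_map y" by blast
  obtain K where K: "cyl y K \<subseteq> G" using open_contains_cyl[OF assms y(1)] by blast
  have "x \<in> G" if "dist (cantor_map x) (cantor_map y) < 1 / 2 / 3 ^ K" for x
  proof -
    have "x \<in> cyl y K"
      using cantor_map_separates[of x y K] that by (simp add: cyl_def dist_real_def)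
    then show ?thesis using K by blast
  qed
  then show "\<exists>e>0. \<forall>x'\<in>cantor_map ` Y. dist x' r < e \<longrightarrow> x' \<in> cantor_map ` (Y \<inter> G)"
    unfolding y(2) by (intro exI[of _ "1 / 2 / 3 ^ K"]) auto
qed blast

section \<open>Exceptional meager sets and covers of the embedded sets\<close>

lemma meager_countable:
  fixes A :: "(nat \<Rightarrow> bool) set"
  assumes "countable A"
  shows "meager A"
proof -
  have "nowhere_dense {a}" for a :: "nat \<Rightarrow> bool"
  proof (rule nowhere_denseI_cyl)
    fix u :: "nat \<Rightarrow> bool" and K :: nat
    show "\<exists>v L. cyl v L \<subseteq> cyl u K \<and> cyl v L \<inter> {a} = {}"
      by (intro exI[of _ "u(K := \<not> a K)"] exI[of _ "Suc K"]) (auto simp: cyl_def)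
  qed
  then have "meager (\<Union>a\<in>A. {a})"
    by (intro meager_UN assms nowhere_dense_imp_meager)
  then show ?thesis by simp
qed

text \<open>Column \<open>n\<close> has positions beyond any initial segment that can still receive
  a one. Outside this set, every column has a first one, which gives a total function.\<close>

lemma meager_zero_column: "meager {x. \<exists>n. \<forall>j. \<not> x (prod_encode (n, j))}"
proof -
  have "nowhere_dense {x. \<forall>j. \<not> x (prod_encode (n, j))}" for n
  proof (rule nowhere_denseI_cyl)
    fix u :: "nat \<Rightarrow> bool" and K :: nat
    show "\<exists>v L. cyl v L \<subseteq> cyl u K \<and> cyl v L \<inter> {x. \<forall>j. \<not> x (prod_encode (n, j))} = {}"
      using le_prod_encode_2[of K n]
      by (intro exI[of _ "u(prod_encode (n, K) := True)"] exI[of _ "Suc (prod_encode (n, K))"])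
        (auto simp: cyl_def)
  qed
  then have "meager (\<Union>n. {x. \<forall>j. \<not> x (prod_encode (n, j))})"
    by (intro meager_UN_nat nowhere_dense_imp_meager)
  moreover have "(\<Union>n. {x. \<forall>j. \<not> x (prod_encode (n, j))}) = {x. \<exists>n. \<forall>j. \<not> x (prod_encode (n, j))}"
    by blast
  ultimately show ?thesis by simp
qed

text \<open>\<open>G n m\<close> collects the points whose first one in column \<open>n\<close> is
  at entry \<open>m\<close> or before. As \<open>G n m\<close> increases with \<open>m\<close>, a
  finite choice from the n-th cover amounts to a bound \<open>M n\<close>, and the pair that
  \<open>dom\<close> gives for \<open>M\<close> lies in no chosen union.\<close>

lemma not_Ufin_cantor_map:
  assumes col: "\<And>y n. y \<in> Y \<Longrightarrow> \<exists>j. y (prod_encode (n, j))"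
    and dom: "\<And>g :: nat \<Rightarrow> nat. \<exists>x\<in>Y. \<exists>y\<in>Y. \<forall>n.
      (\<forall>j\<le>g n. \<not> x (prod_encode (n, j))) \<or> (\<forall>j\<le>g n. \<not> y (prod_encode (n, j)))"
  shows "\<not> Ufin (cantor_map ` Y) (Gamma_covers (cantor_map ` Y)) (Omega (cantor_map ` Y))"
proof
  assume U: "Ufin (cantor_map ` Y) (Gamma_covers (cantor_map ` Y)) (Omega (cantor_map ` Y))"
  define T where "T n m = {y. \<exists>j\<le>m. y (prod_encode (n, j))}" for n m
  define G where "G n m = cantor_map ` (Y \<inter> T n m)" for n m
  have openT: "open (T n m)" for n m
  proof (subst open_subopen, intro ballI)
    fix y assume "y \<in> T n m"
    then obtain j where "j \<le> m" "y (prod_encode (n, j))" by (auto simp: T_def)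
    then have "cyl y (Suc (prod_encode (n, j))) \<subseteq> T n m" by (auto simp: T_def cyl_def)
    then show "\<exists>S. open S \<and> y \<in> S \<and> S \<subseteq> T n m"
      by (intro exI[of _ "cyl y (Suc (prod_encode (n, j)))"] conjI open_cyl cyl_self)
  qed
  have G_iff: "cantor_map y \<in> G n m \<longleftrightarrow> y \<in> Y \<and> (\<exists>j\<le>m. y (prod_encode (n, j)))" for y n m
    using inj_cantor_map by (auto simp: G_def T_def inj_def)
  have G_mono: "G n m \<subseteq> G n m'" if "m \<le> m'" for n m m'
    using that by (auto simp: G_def T_def intro: order_trans)
  have bounded: "\<exists>M. \<Union>\<F> \<subseteq> G n M" if \<F>: "finite \<F>" "\<F> \<subseteq> range (G n)" for \<F> n
  proof -
    obtain C where C: "finite C" "\<F> = G n ` C"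
      using finite_subset_image[OF \<F>] by blast
    obtain M where "\<forall>m\<in>C. m < M" using C(1) finite_nat_set_iff_bounded by blast
    then have "\<Union>\<F> \<subseteq> G n M" using G_mono C(2) by (force dest: less_imp_le)
    then show ?thesis by blast
  qed
  have no_subcover: "\<not> (\<exists>\<F>. finite \<F> \<and> \<F> \<subseteq> range (G n) \<and> \<Union>\<F> = cantor_map ` Y)" for n
  proof
    assume "\<exists>\<F>. finite \<F> \<and> \<F> \<subseteq> range (G n) \<and> \<Union>\<F> = cantor_map ` Y"
    then obtain M where M: "cantor_map ` Y \<subseteq> G n M" using bounded by metis
    \<comment> \<open>A constant function suffices, since only column \<open>n\<close> is at
      stake.\<close>
    obtain x y where "x \<in> Y" "y \<in> Y"
      "(\<forall>j\<le>M. \<not> x (prod_encode (n, j))) \<or> (\<forall>j\<le>M. \<not> y (prod_encode (n, j)))"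
      using dom[of "\<lambda>_. M"] by blast
    then show False using M G_iff by blast
  qed
  have cover: "\<Union>(range (G n)) = cantor_map ` Y" for n
    using col by (fastforce simp: G_def T_def)
  have "range (G n) \<in> Gamma_covers (cantor_map ` Y)" for n
  proof -
    \<comment> \<open>A finite range would itself be a finite subcover.\<close>
    have "infinite (range (G n))"
      using no_subcover[of n] cover[of n] by blast
    moreover have "finite {S \<in> range (G n). r \<notin> S}" if r: "r \<in> cantor_map ` Y" for r
    proof -
      obtain y where y: "y \<in> Y" "r = cantor_map y" using r by blast
      obtain j where j: "y (prod_encode (n, j))" using col y(1) by blast
      have "{S \<in> range (G n). r \<notin> S} \<subseteq> G n ` {..<j}"
      proof
        fix S assume "S \<in> {S \<in> range (G n). r \<notin> S}"
        then obtain m where m: "S = G n m" "r \<notin> G n m" by blast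
        then have "m < j" using j y G_iff not_le by blast
        then show "S \<in> G n ` {..<j}" using m(1) by blast
      qed
      then show ?thesis by (rule finite_subset) simp
    qed
    ultimately show ?thesis
      using openin_cantor_map_image[OF openT] cover
      by (auto simp: Gamma_covers_def countable_open_cover_def gamma_covering_def G_def)
  qed
  then have "\<forall>n. range (G n) \<in> Gamma_covers (cantor_map ` Y) \<and>
      \<not> (\<exists>\<F>. finite \<F> \<and> \<F> \<subseteq> range (G n) \<and> \<Union>\<F> = cantor_map ` Y)"
    using no_subcover by (intro allI conjI)
  from U[unfolded Ufin_def, THEN spec, THEN mp, OF this]
  obtain \<V> where \<V>: "\<forall>n. finite (\<V> n) \<and> \<V> n \<subseteq> range (G n)"
    "range (\<lambda>n. \<Union>(\<V> n)) \<in> Omega (cantor_map ` Y)"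
    by (elim exE conjE)
  have "\<forall>n. \<exists>M. \<Union>(\<V> n) \<subseteq> G n M" using bounded \<V>(1) by blast
  then obtain M where M: "\<And>n. \<Union>(\<V> n) \<subseteq> G n (M n)" by metis
  obtain x y where xy: "x \<in> Y" "y \<in> Y"
    "\<And>n. (\<forall>j\<le>M n. \<not> x (prod_encode (n, j))) \<or> (\<forall>j\<le>M n. \<not> y (prod_encode (n, j)))"
    using dom[of M] by blast
  have "finite {cantor_map x, cantor_map y} \<and> {cantor_map x, cantor_map y} \<subseteq> cantor_map ` Y"
    using xy(1,2) by simp
  then have "\<exists>W\<in>range (\<lambda>n. \<Union>(\<V> n)). {cantor_map x, cantor_map y} \<subseteq> W"
    using \<V>(2) unfolding Omega_def omega_covering_def by blast
  then obtain n where "cantor_map x \<in> \<Union>(\<V> n)" "cantor_map y \<in> \<Union>(\<V> n)" by blast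
  then have "cantor_map x \<in> G n (M n)" "cantor_map y \<in> G n (M n)" using M by blast+
  then show False using xy(3)[of n] G_iff by blast
qed

text \<open>Membership of \<open>\<beta>\<close> in \<open>insert \<alpha> (below \<alpha>)\<close>
  says that stage \<open>\<alpha>\<close> is \<open>\<beta>\<close> or later. By
  \<open>dense\<close> and \<open>avoid\<close>, an omega-cover enumerated at \<open>\<beta>\<close>
  is one modulo the meager ideal; \<open>sel\<close> passes this on to the selection.\<close>

lemma S1_B_Omega_cantor_map:
  fixes p :: "nat set \<Rightarrow> nat \<Rightarrow> bool"
  assumes dense: "\<And>\<beta> m. \<exists>\<alpha>. \<beta> \<in> insert \<alpha> (below \<alpha>) \<and> p \<alpha> \<in> basic m"
    and avoid: "\<And>\<alpha> \<beta> n k m. \<beta> \<in> insert \<alpha> (below \<alpha>) \<Longrightarrow> meager (E \<beta> n k \<inter> basic m) \<Longrightarrow>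
      p \<alpha> \<notin> E \<beta> n k \<inter> basic m"
    and sel: "\<And>\<beta> A. (\<And>A n. finite A \<Longrightarrow> good (p ` A) (E \<beta> n)) \<Longrightarrow> finite A \<Longrightarrow>
      good (p ` A) (\<lambda>n. E \<beta> n (s \<beta> n))"
    and enum: "\<And>E'. (\<And>n k. E' n k \<in> sets borel) \<Longrightarrow> \<exists>\<beta>. E \<beta> = E'"
  shows "S1 (B_Omega (cantor_map ` range p)) (B_Omega (cantor_map ` range p))"
  unfolding S1_def
proof (intro allI impI)
  define X where "X = cantor_map ` range p"
  fix \<U> :: "nat \<Rightarrow> real set set" assume "\<forall>n. \<U> n \<in> B_Omega (cantor_map ` range p)"
  then have \<U>: "countable (\<U> n)" "\<And>U. U \<in> \<U> n \<Longrightarrow> U \<in> sets (restrict_space borel X)"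
    "X \<notin> \<U> n" "\<And>F. finite F \<Longrightarrow> F \<subseteq> X \<Longrightarrow> \<exists>U\<in>\<U> n. F \<subseteq> U" for n
    unfolding B_Omega_def countable_borel_cover_def omega_covering_def X_def by auto
  define U where "U n k = from_nat_into (\<U> n) k" for n k
  have "\<U> n \<noteq> {}" for n using \<U>(4)[of "{}" n] by auto
  then have U: "range (U n) = \<U> n" for n
    using range_from_nat_into[OF _ \<U>(1)] by (simp add: U_def)
  \<comment> \<open>Relatively Borel members are traces of Borel sets of the line, whose preimages
    under \<open>cantor_map\<close> form a sequence that occurs in the enumeration.\<close>
  have "\<forall>n k. \<exists>A. A \<in> sets borel \<and> U n k = X \<inter> A"
  proof (intro allI)
    fix n k
    have "U n k \<in> \<U> n" using U rangeI by metis
    then have "U n k \<in> sets (restrict_space borel X)" by (rule \<U>(2))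
    then show "\<exists>A. A \<in> sets borel \<and> U n k = X \<inter> A"
      by (auto simp: sets_restrict_space)
  qed
  then obtain A where A: "\<And>n k. A n k \<in> sets borel" "\<And>n k. U n k = X \<inter> A n k" by metis
  have "cantor_map -` A n k \<in> sets borel" for n k
    using measurable_sets[OF borel_measurable_continuous_onI[OF continuous_cantor_map] A(1)] by simp
  then obtain \<beta> where \<beta>: "E \<beta> = (\<lambda>n k. cantor_map -` A n k)"
    using enum[of "\<lambda>n k. cantor_map -` A n k"] by blast
  have in_U: "cantor_map (p \<gamma>) \<in> U n k \<longleftrightarrow> p \<gamma> \<in> E \<beta> n k" for \<gamma> n k
    by (simp add: A(2) \<beta> X_def)
  have good_E: "good (p ` D) (E \<beta> n)" if "finite D" for D n
    unfolding good_def
  proof (intro allI impI)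
    fix T :: "nat set" assume "finite T"
    \<comment> \<open>A member containing the late points \<open>p (c m)\<close> is nonmeager in
      each \<open>basic m\<close> with \<open>m\<close> in \<open>T\<close>, for otherwise
      \<open>avoid\<close> would exclude \<open>p (c m)\<close> from it.\<close>
    obtain c where c: "\<And>m. \<beta> \<in> insert (c m) (below (c m))" "\<And>m. p (c m) \<in> basic m"
      using dense by metis
    have "\<exists>V\<in>\<U> n. cantor_map ` p ` (D \<union> c ` T) \<subseteq> V"
      by (rule \<U>(4)) (use \<open>finite D\<close> \<open>finite T\<close> in \<open>auto simp: X_def\<close>)
    then obtain k where k': "cantor_map ` p ` (D \<union> c ` T) \<subseteq> U n k"
      unfolding U[of n, symmetric] by (elim bexE rangeE) simp
    have k: "p ` (D \<union> c ` T) \<subseteq> E \<beta> n k"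
    proof (rule image_subsetI)
      fix \<gamma> assume "\<gamma> \<in> D \<union> c ` T"
      then have "cantor_map (p \<gamma>) \<in> U n k" using k' by blast
      then show "p \<gamma> \<in> E \<beta> n k" by (simp only: in_U)
    qed
    have "\<not> meager (E \<beta> n k \<inter> basic m)" if "m \<in> T" for m
    proof -
      have "p (c m) \<in> E \<beta> n k \<inter> basic m" using k c(2) that by blast
      then show ?thesis using avoid[OF c(1)[of m]] by blast
    qed
    then show "\<exists>k. p ` D \<subseteq> E \<beta> n k \<and> (\<forall>m\<in>T. \<not> meager (E \<beta> n k \<inter> basic m))"
      using k by blast
  qed
  define V where "V n = U n (s \<beta> n)" for n
  have V: "V n \<in> \<U> n" for n unfolding U[of n, symmetric] V_def by (rule rangeI)
  have omega: "\<exists>W\<in>range V. F \<subseteq> W" if F: "finite F" "F \<subseteq> X" for F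
  proof -
    obtain D where D: "finite D" "F = (\<lambda>\<gamma>. cantor_map (p \<gamma>)) ` D"
      using finite_subset_image[OF F(1), of "\<lambda>\<gamma>. cantor_map (p \<gamma>)" UNIV] F(2)
      unfolding X_def image_image by blast
    have "good (p ` D) (\<lambda>n. E \<beta> n (s \<beta> n))"
      by (rule sel) (rule good_E, assumption, rule D(1))
    then obtain n where "p ` D \<subseteq> E \<beta> n (s \<beta> n)"
      unfolding good_def by (meson finite.emptyI)
    then have "F \<subseteq> V n" unfolding V_def D(2) using in_U by (intro image_subsetI) (simp add: image_subset_iff)
    then show ?thesis by blast
  qed
  have "\<Union>(range V) = X"
  proof
    show "\<Union>(range V) \<subseteq> X" using A(2) by (auto simp: V_def)
    show "X \<subseteq> \<Union>(range V)"
    proof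
      fix x assume "x \<in> X"
      then show "x \<in> \<Union>(range V)" using omega[of "{x}"] by auto
    qed
  qed
  moreover have "X \<notin> range V" using V \<U>(3) by (metis rangeE)
  moreover have "\<forall>W\<in>range V. W \<in> sets (restrict_space borel X)" using V \<U>(2) by blast
  ultimately have "range V \<in> B_Omega X"
    using omega unfolding B_Omega_def countable_borel_cover_def omega_covering_def by simp
  then show "\<exists>U. (\<forall>n. U n \<in> \<U> n) \<and> range U \<in> B_Omega (cantor_map ` range p)"
    using V unfolding X_def by blast
qed

section \<open>The two generic sets of reals and their union\<close>

theorem theorem3p4:
  assumes "\<And>\<M> :: (nat \<Rightarrow> bool) set set.
     (\<forall>M\<in>\<M>. meager M) \<Longrightarrow> \<M> \<prec> (UNIV :: nat set set) \<Longrightarrow> \<Union>\<M> \<noteq> UNIV"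
  shows "\<exists>X1 X2 :: real set. X1 \<subseteq> - \<rat> \<and> X2 \<subseteq> - \<rat>
     \<and> S1 (B_Omega X1) (B_Omega X1) \<and> S1 (B_Omega X2) (B_Omega X2)
     \<and> \<not> Ufin (X1 \<union> X2) (Gamma_covers (X1 \<union> X2)) (Omega (X1 \<union> X2))"
proof -
  have cov: cov_meager_continuum
    unfolding cov_meager_continuum_def using assms by blast
  obtain E :: "nat set \<Rightarrow> nat \<Rightarrow> nat \<Rightarrow> (nat \<Rightarrow> bool) set"
    and g :: "nat set \<Rightarrow> nat \<Rightarrow> nat" and w :: "nat set \<Rightarrow> nat"
    where E: "\<And>\<alpha> n k. E \<alpha> n k \<in> sets borel"
      and enum: "\<And>E' g' w'. (\<And>n k. E' n k \<in> sets borel) \<Longrightarrow>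
           (UNIV :: nat set set) \<lesssim> {\<alpha>. E \<alpha> = E' \<and> g \<alpha> = g' \<and> w \<alpha> = w'}"
    by (rule enumeration_of_parameters) blast
  define \<psi> where "\<psi> i \<alpha> = (if i then first_part else second_part (g \<alpha>))" for i \<alpha>
  have \<psi>: "nondegenerate (\<psi> i \<alpha>)" for i \<alpha>
    by (simp add: \<psi>_def nondegenerate_first_part nondegenerate_second_part)
  \<comment> \<open>Avoiding \<open>N\<close> makes the images irrational and gives every point a
    one in each column.\<close>
  define N where "N = cantor_map -` \<rat> \<union> {x. \<exists>n. \<forall>j. \<not> x (prod_encode (n, j))}"
  have "countable (cantor_map -` \<rat>)"
    by (rule countable_image_inj_on[OF _ inj_on_subset[OF inj_cantor_map subset_UNIV]])
      (rule countable_subset[OF _ countable_rat], blast)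
  then have N: "meager N"
    unfolding N_def by (intro meager_Un meager_countable meager_zero_column)
  obtain b z where z: "\<And>\<alpha>. z \<alpha> \<in> basic (w \<alpha>)"
    and ok: "\<And>\<alpha>. stage_ok E N (\<lambda>i \<gamma>. \<psi> i \<gamma> (z \<gamma>)) (\<lambda>\<gamma> n. E \<gamma> n (select (b \<gamma>) n)) \<alpha>"
    by (rule generic_construction[where E=E and \<psi>=\<psi>, OF cov E \<psi> N, of w]) blast
  define p where "p i \<gamma> = \<psi> i \<gamma> (z \<gamma>)" for i \<gamma>
  have ok: "stage_ok E N p (\<lambda>\<gamma> n. E \<gamma> n (select (b \<gamma>) n)) \<alpha>" for \<alpha>
    using ok[of \<alpha>] unfolding p_def .
  have dense: "\<exists>\<alpha>. \<beta> \<in> insert \<alpha> (below \<alpha>) \<and> p i \<alpha> \<in> basic m" for i \<beta> m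
  proof -
    define \<phi> where "\<phi> = (if i then first_part else second_part (\<lambda>_. 0))"
    obtain u K where "basic m = cyl u K" using basic_eq_cyl by blast
    then have u: "u \<in> basic m" by simp
    obtain y where "\<phi> y = u"
      using first_part_surj second_part_surj unfolding \<phi>_def by metis
    moreover have "open (\<phi> -` basic m)"
      using nondegenerate_first_part nondegenerate_second_part open_basic
      by (intro open_vimage) (auto simp: \<phi>_def nondegenerate_def)
    ultimately obtain w' where w': "basic w' \<subseteq> \<phi> -` basic m"
      using open_contains_basic[of "\<phi> -` basic m" y] u by auto
    \<comment> \<open>At these stages \<open>p i\<close> applies \<open>\<phi>\<close> to a point of
      \<open>basic w'\<close> and so lands in \<open>basic m\<close>. There are continuum many of
      them, too many to fit below \<open>\<beta>\<close>.\<close>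
    let ?A = "{\<alpha>. E \<alpha> = (\<lambda>_ _. {}) \<and> g \<alpha> = (\<lambda>_. 0) \<and> w \<alpha> = w'}"
    have "\<not> ?A \<subseteq> below \<beta>"
    proof
      assume "?A \<subseteq> below \<beta>"
      then have "?A \<prec> (UNIV :: nat set set)"
        using subset_imp_lepoll below_lesspoll lesspoll_trans1 by blast
      then have "?A \<prec> ?A" using enum[of "\<lambda>_ _. {}" "\<lambda>_. 0" w'] lesspoll_trans2 by blast
      then show False by simp
    qed
    then obtain \<alpha> where \<alpha>: "\<alpha> \<notin> below \<beta>" "g \<alpha> = (\<lambda>_. 0)" "w \<alpha> = w'" by blast
    have "\<beta> \<in> insert \<alpha> (below \<alpha>)" using \<alpha>(1) below_total by blast
    moreover have "p i \<alpha> = \<phi> (z \<alpha>)" by (simp add: p_def \<psi>_def \<phi>_def \<alpha>(2))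
    moreover have "z \<alpha> \<in> basic w'" using z[of \<alpha>] \<alpha>(3) by simp
    ultimately show ?thesis using w' by (metis subsetD vimageD)
  qed
  have ex: "\<exists>\<beta>. E \<beta> = E' \<and> g \<beta> = g'" if "\<And>n k. E' n k \<in> sets borel" for E' g'
  proof (rule ccontr)
    assume "\<not> ?thesis"
    then have empty: "{\<alpha>. E \<alpha> = E' \<and> g \<alpha> = g' \<and> w \<alpha> = 0} = {}" by blast
    show False using enum[where E'=E' and g'=g' and w'=0] that unfolding empty by simp
  qed
  define X where "X i = cantor_map ` range (p i)" for i
  have S1: "S1 (B_Omega (X i)) (B_Omega (X i))" for i
    unfolding X_def
  proof (rule S1_B_Omega_cantor_map[where E=E and s="\<lambda>\<beta>. select (b \<beta>)"])
    show "\<exists>\<alpha>. \<beta> \<in> insert \<alpha> (below \<alpha>) \<and> p i \<alpha> \<in> basic m" for \<beta> m by (rule dense)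
    show "p i \<alpha> \<notin> E \<beta> n k \<inter> basic m"
      if "\<beta> \<in> insert \<alpha> (below \<alpha>)" "meager (E \<beta> n k \<inter> basic m)" for \<alpha> \<beta> n k m
      using stage_okD(3)[OF ok that] .
    show "good (p i ` A) (\<lambda>n. E \<beta> n (select (b \<beta>) n))"
      if "\<And>A n. finite A \<Longrightarrow> good (p i ` A) (E \<beta> n)" "finite A" for \<beta> A
      using good_selected[OF ok that] .
    show "\<exists>\<beta>. E \<beta> = E'" if "\<And>n k. E' n k \<in> sets borel" for E'
      using ex[of E', OF that] by blast
  qed
  have pN: "p i \<alpha> \<notin> N" for i \<alpha> using stage_okD(1)[OF ok] .
  then have irr: "X i \<subseteq> - \<rat>" for i
    by (auto simp: X_def N_def)
  have XY: "X True \<union> X False = cantor_map ` (range (p True) \<union> range (p False))"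
    by (auto simp: X_def)
  have "\<not> Ufin (X True \<union> X False) (Gamma_covers (X True \<union> X False)) (Omega (X True \<union> X False))"
    unfolding XY
  proof (rule not_Ufin_cantor_map)
    show "\<exists>j. y (prod_encode (n, j))" if "y \<in> range (p True) \<union> range (p False)" for y n
      using that pN by (auto simp: N_def)
    fix g' :: "nat \<Rightarrow> nat"
    \<comment> \<open>The two points added at a stage with parameter \<open>g'\<close> form the
      required pair.\<close>
    obtain \<alpha> where "g \<alpha> = g'" using ex[of "\<lambda>_ _. {}" g'] by auto
    then have "\<forall>n. (\<forall>j\<le>g' n. \<not> p True \<alpha> (prod_encode (n, j))) \<or> (\<forall>j\<le>g' n. \<not> p False \<alpha> (prod_encode (n, j)))"
      using first_or_second_part_large[of g' _ "z \<alpha>"] by (auto simp: p_def \<psi>_def)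
    then show "\<exists>x\<in>range (p True) \<union> range (p False). \<exists>y\<in>range (p True) \<union> range (p False). \<forall>n.
      (\<forall>j\<le>g' n. \<not> x (prod_encode (n, j))) \<or> (\<forall>j\<le>g' n. \<not> y (prod_encode (n, j)))"
      by blast
  qed
  then show ?thesis using S1 irr by blast
qed

end
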